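(* Let $N\geq 5$ be an integer and let $\alpha,\beta$ satisfy $-N<\alpha-2\leq\beta\leq\frac{N\alpha}{N-2}$. Then there is a constant $\mathcal{S}>0$ such that $$\int_{\mathbb{R}^N}|x|^{-\beta}|\mathrm{div}(|x|^{\alpha}\nabla u)|^2\,dx\geq\mathcal{S}\left(\int_{\mathbb{R}^N}|x|^{\beta}|u|^{2^{**}_{\alpha,\beta}}\,dx\right)^{\frac{2}{2^{**}_{\alpha,\beta}}},\qquad\forall u\in C^\infty_0(\mathbb{R}^N),$$ where $2^{**}_{\alpha,\beta}:=\frac{2(N+\beta)}{N-4+2\alpha-\beta}$. *)

theory Defs
  imports "HOL-Analysis.Analysis"
begin

primrec Ck_fun :: "nat \<Rightarrow> ('a::euclidean_space \<Rightarrow> real) \<Rightarrow> bool" where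
  "Ck_fun 0 f \<longleftrightarrow> continuous_on UNIV f"
| "Ck_fun (Suc k) f \<longleftrightarrow>
     f differentiable_on UNIV \<and> (\<forall>v. Ck_fun k (\<lambda>x. frechet_derivative f (at x) v))"

definition smooth_fun :: "('a::euclidean_space \<Rightarrow> real) \<Rightarrow> bool" where
  "smooth_fun f \<longleftrightarrow> (\<forall>k. Ck_fun k f)"

definition test_fun :: "('a::euclidean_space \<Rightarrow> real) \<Rightarrow> bool" where
  "test_fun f \<longleftrightarrow> smooth_fun f \<and> compact (closure {x. f x \<noteq> 0})"

text \<open>The gradient and the divergence have unspecified values where the function or the
  vector field is not differentiable. In the field \<open>|x|\<^sup>\<alpha> \<nabla>u\<close> this can only happen at
  the origin, which is a null set. The same applies to the convention \<open>0 powr a = 0\<close>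
  in the weights.\<close>

definition gradient :: "(real ^ 'n \<Rightarrow> real) \<Rightarrow> real ^ 'n \<Rightarrow> real ^ 'n" where
  "gradient f x = (\<chi> i. frechet_derivative f (at x) (axis i 1))"

definition divergence :: "(real ^ 'n \<Rightarrow> real ^ 'n) \<Rightarrow> real ^ 'n \<Rightarrow> real" where
  "divergence F x = (\<Sum>i\<in>UNIV. frechet_derivative F (at x) (axis i 1) $ i)"

definition crit_exp :: "real \<Rightarrow> real \<Rightarrow> real \<Rightarrow> real" where
  "crit_exp N \<alpha> \<beta> = 2 * (N + \<beta>) / (N - 4 + 2 * \<alpha> - \<beta>)"

end

theory Submission
  imports Defs
begin

text \<open>Write \<open>L u = div(|x|\<^sup>\<alpha> \<nabla>u)\<close>, let \<open>p\<close> be the critical exponent and \<open>q = (p + 2) / 2 \<ge> 2\<close>.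
  Testing \<open>L u\<close> against \<open>|u|\<close> to the power \<open>q - 2\<close> times \<open>u\<close> and using Cauchy--Schwarz gives
  \<open>(q - 1) E \<le> sqrt (A P)\<close>, where \<open>A\<close> is the left-hand side of the claim,
  \<open>P = \<integral> |x|\<^sup>\<beta> |u|\<^sup>p\<close> (because \<open>2q - 2 = p\<close>) and \<open>E\<close> is, up to a constant, the weighted Dirichlet
  energy of \<open>v\<close>, the power \<open>q / 2\<close> of \<open>|u|\<close>. The first-order Caffarelli--Kohn--Nirenberg inequality for \<open>v\<close>
  has the same weights and the same range of \<open>\<beta>\<close>, and reads: \<open>P\<close> is at most a constant times \<open>E\<close> to the
  power \<open>p / q\<close>. The two estimates together give the claim, so no second-order regularity theory is
  needed. The first-order inequality is interpolated between Hardy's inequality (\<open>\<beta> = \<alpha> - 2\<close>) and a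
  weighted Sobolev inequality (\<open>\<beta> = N\<alpha> / (N - 2)\<close>), which is the Gagliardo--Nirenberg \<open>L\<^sup>1\<close> inequality
  applied to \<open>|x|\<^sup>a |u|\<^sup>k\<close> with \<open>a = \<alpha>(N - 1) / (N - 2)\<close> and \<open>k = q(N - 1) / (N - 2)\<close>. The
  singular weights are handled by Fubini, since almost every line parallel to an axis avoids the origin.\<close>

section \<open>Hoelder's inequality for extended nonnegative functions\<close>

text \<open>Jensen's inequality for the concave \<open>ln\<close>. A vanishing \<open>y j\<close>
  makes the product 0, because \<open>0 powr w j = 0\<close>.\<close>

lemma weighted_arith_geom_mean:
  fixes w y :: "'i \<Rightarrow> real"
  assumes "finite J" "\<And>j. j \<in> J \<Longrightarrow> w j > 0" "(\<Sum>j\<in>J. w j) = 1" "\<And>j. j \<in> J \<Longrightarrow> y j \<ge> 0"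
  shows "(\<Prod>j\<in>J. y j powr w j) \<le> (\<Sum>j\<in>J. w j * y j)"
proof (cases "\<exists>j\<in>J. y j = 0")
  case True
  then have "(\<Prod>j\<in>J. y j powr w j) = 0"
    using assms by auto
  moreover have "(\<Sum>j\<in>J. w j * y j) \<ge> 0"
    using assms by (intro sum_nonneg) (simp add: less_imp_le)
  ultimately show ?thesis by simp
next
  case False
  have J: "J \<noteq> {}" using assms(3) by auto
  have pos: "y j > 0" if "j \<in> J" for j
    using False assms(4)[OF that] that by force
  have "(\<Sum>j\<in>J. w j * ln (y j)) \<le> ln (\<Sum>j\<in>J. w j *\<^sub>R y j)"
  proof (intro concave_on_sum)
    show "concave_on {0<..} ln" by (simp add: ln_concave)
  qed (use assms pos J in \<open>auto simp: less_imp_le\<close>)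
  moreover have s: "(\<Sum>j\<in>J. w j *\<^sub>R y j) > 0"
    using assms pos J by (intro sum_pos) auto
  ultimately have "exp (\<Sum>j\<in>J. w j * ln (y j)) \<le> (\<Sum>j\<in>J. w j *\<^sub>R y j)"
    by (metis ln_ge_iff)
  moreover have "exp (\<Sum>j\<in>J. w j * ln (y j)) = (\<Prod>j\<in>J. y j powr w j)"
    unfolding exp_sum[OF \<open>finite J\<close>] using pos by (intro prod.cong) (auto simp: powr_def, metis less_irrefl)
  ultimately show ?thesis by simp
qed

text \<open>The library has no real powers on \<^typ>\<open>ennreal\<close>. Here \<open>epow x 0 = 1\<close>, also at \<open>x = 0\<close>, in contrast to
  \<open>0 powr 0 = 0\<close> on the reals; negative exponents are not intended.\<close>

definition epow :: "ennreal \<Rightarrow> real \<Rightarrow> ennreal" where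
  "epow x s = (if s = 0 then 1 else if x = top then top else ennreal (enn2real x powr s))"

lemma epow_0 [simp]: "epow x 0 = 1"
  by (simp add: epow_def)

lemma epow_top [simp]: "s \<noteq> 0 \<Longrightarrow> epow top s = top"
  by (simp add: epow_def)

lemma epow_ennreal: "r \<ge> 0 \<Longrightarrow> s \<noteq> 0 \<Longrightarrow> epow (ennreal r) s = ennreal (r powr s)"
  by (simp add: epow_def)

lemma epow_eq_0_iff: "epow x s = 0 \<longleftrightarrow> x = 0 \<and> s \<noteq> 0"
  by (cases x) (auto simp: epow_def ennreal_eq_0_iff)

lemma epow_mono: "x \<le> y \<Longrightarrow> s \<ge> 0 \<Longrightarrow> epow x s \<le> epow y s"
  by (cases x; cases y) (auto simp: epow_def top_unique intro!: powr_mono2 ennreal_leI)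

lemma epow_add: "a \<ge> 0 \<Longrightarrow> b \<ge> 0 \<Longrightarrow> epow x (a + b) = epow x a * epow x b"
  by (cases x) (auto simp: epow_def powr_add ennreal_mult ennreal_mult_top ennreal_top_mult add_nonneg_eq_0_iff)

lemma borel_measurable_epow [measurable]:
  assumes [measurable]: "f \<in> borel_measurable M"
  shows "(\<lambda>x. epow (f x) s) \<in> borel_measurable M"
  unfolding epow_def by measurable

text \<open>The scales \<open>c j\<close> are free: the weighted mean inequality is applied to
  \<open>x j / c j\<close>. In Hoelder's inequality below, \<open>c j\<close> is the integral of the
  j-th factor. If some \<open>x j\<close> is infinite, so is the right-hand side.\<close>

lemma epow_prod_le:
  fixes w :: "'i \<Rightarrow> real" and c :: "'i \<Rightarrow> real" and x :: "'i \<Rightarrow> ennreal"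
  assumes fin: "finite J" and w: "\<And>j. j \<in> J \<Longrightarrow> w j > 0" and w1: "(\<Sum>j\<in>J. w j) = 1"
    and c: "\<And>j. j \<in> J \<Longrightarrow> c j > 0"
  shows "(\<Prod>j\<in>J. epow (x j) (w j))
    \<le> ennreal (\<Prod>j\<in>J. c j powr w j) * (\<Sum>j\<in>J. ennreal (w j / c j) * x j)"
proof (cases "\<exists>j\<in>J. x j = top")
  case True
  then obtain k where k: "k \<in> J" "x k = top" by auto
  have "ennreal (w k / c k) * x k = top"
    using k w[OF k(1)] c[OF k(1)] by (simp add: ennreal_mult_top)
  then have "(\<Sum>j\<in>J. ennreal (w j / c j) * x j) = top"
    using k fin by (simp add: sum.remove[of J k])
  moreover have "(\<Prod>j\<in>J. c j powr w j) > 0"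
    using c by (intro prod_pos) (auto simp: less_le)
  ultimately show ?thesis by (simp add: ennreal_mult_top)
next
  case False
  define y where "y j = enn2real (x j)" for j
  have xy: "x j = ennreal (y j)" if "j \<in> J" for j
    using False that by (auto simp: y_def less_top)
  have y0: "y j \<ge> 0" for j by (simp add: y_def)
  have "(\<Prod>j\<in>J. (y j / c j) powr w j) \<le> (\<Sum>j\<in>J. w j * (y j / c j))"
    using assms y0 by (intro weighted_arith_geom_mean) (auto simp: less_imp_le)
  also have "(\<Prod>j\<in>J. (y j / c j) powr w j) = (\<Prod>j\<in>J. y j powr w j) / (\<Prod>j\<in>J. c j powr w j)"
    unfolding prod_dividef[symmetric] using c y0
    by (intro prod.cong) (auto simp: powr_divide less_imp_le)
  finally have "(\<Prod>j\<in>J. y j powr w j) \<le> (\<Prod>j\<in>J. c j powr w j) * (\<Sum>j\<in>J. w j / c j * y j)"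
  proof -
    assume a: "(\<Prod>j\<in>J. y j powr w j) / (\<Prod>j\<in>J. c j powr w j) \<le> (\<Sum>j\<in>J. w j * (y j / c j))"
    have "(\<Prod>j\<in>J. c j powr w j) > 0" using c by (intro prod_pos) (auto simp: less_le)
    then show ?thesis using a by (simp add: divide_le_eq mult.commute)
  qed
  then have "ennreal (\<Prod>j\<in>J. y j powr w j)
      \<le> ennreal ((\<Prod>j\<in>J. c j powr w j) * (\<Sum>j\<in>J. w j / c j * y j))"
    by (rule ennreal_leI)
  also have "\<dots> = ennreal (\<Prod>j\<in>J. c j powr w j) * (\<Sum>j\<in>J. ennreal (w j / c j) * ennreal (y j))"
  proof -
    have "ennreal (\<Sum>j\<in>J. w j / c j * y j) = (\<Sum>j\<in>J. ennreal (w j / c j * y j))"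
      using w c y0 by (intro sum_ennreal[symmetric]) (auto simp: less_imp_le)
    also have "\<dots> = (\<Sum>j\<in>J. ennreal (w j / c j) * ennreal (y j))"
      using w c y0 by (intro sum.cong refl, subst ennreal_mult[symmetric]) (auto simp: less_imp_le)
    finally show ?thesis
      using w c y0 by (subst ennreal_mult) (auto intro!: prod_nonneg sum_nonneg simp: less_imp_le)
  qed
  also have "ennreal (\<Prod>j\<in>J. y j powr w j) = (\<Prod>j\<in>J. ennreal (y j powr w j))"
    by (intro prod_ennreal[symmetric]) auto
  also have "\<dots> = (\<Prod>j\<in>J. epow (x j) (w j))"
    using xy y0 w by (intro prod.cong) (auto simp: epow_ennreal less_imp_neq[symmetric] dest: less_imp_neq)
  finally show ?thesis using xy by simp
qed

text \<open>Hoelder's inequality for finitely many factors. Normalising each factor by its integral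
  reduces it to \<open>epow_prod_le\<close>, since the integrated weighted sum is then the total
  weight 1.\<close>

lemma nn_integral_prod_epow_le:
  fixes w :: "'i \<Rightarrow> real" and g :: "'i \<Rightarrow> 'b \<Rightarrow> ennreal"
  assumes fin: "finite J" and w0: "\<And>j. j \<in> J \<Longrightarrow> w j \<ge> 0" and w1: "(\<Sum>j\<in>J. w j) = 1"
    and meas: "\<And>j. j \<in> J \<Longrightarrow> g j \<in> borel_measurable M"
  shows "(\<integral>\<^sup>+x. (\<Prod>j\<in>J. epow (g j x) (w j)) \<partial>M) \<le> (\<Prod>j\<in>J. epow (\<integral>\<^sup>+x. g j x \<partial>M) (w j))"
proof -
  \<comment> \<open>Factors of weight 0 equal 1 on both sides, as \<open>epow x 0 = 1\<close>.
    Dropping them leaves the positive weights that \<open>epow_prod_le\<close> demands.\<close>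
  define K where "K = {j\<in>J. w j > 0}"
  have K: "K \<subseteq> J" "finite K" using fin by (auto simp: K_def)
  have wK: "w j > 0" if "j \<in> K" for j using that by (simp add: K_def)
  have J: "\<forall>j\<in>J - K. w j = 0" using w0 by (force simp: K_def)
  have wK1: "(\<Sum>j\<in>K. w j) = 1"
    using w1 sum.mono_neutral_right[OF fin K(1), of w] J by simp
  have red: "(\<Prod>j\<in>J. epow (h j) (w j)) = (\<Prod>j\<in>K. epow (h j) (w j))" for h
    using J by (intro prod.mono_neutral_right[OF fin K(1)]) simp
  define I where "I j = (\<integral>\<^sup>+x. g j x \<partial>M)" for j
  have measK: "g j \<in> borel_measurable M" if "j \<in> K" for j
    using meas that K by auto
  have "(\<integral>\<^sup>+x. (\<Prod>j\<in>K. epow (g j x) (w j)) \<partial>M) \<le> (\<Prod>j\<in>K. epow (I j) (w j))"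
  proof -
    \<comment> \<open>A zero integral makes the integrand vanish almost everywhere. If no integral
      is zero but one is infinite, the right-hand side is infinite. Otherwise all integrals can
      serve as normalising scales.\<close>
    consider (zero) k where "k \<in> K" "I k = 0"
      | (inf) k where "\<forall>j\<in>K. I j \<noteq> 0" "k \<in> K" "I k = top"
      | (fin) "\<forall>j\<in>K. I j \<noteq> 0 \<and> I j \<noteq> top" by auto
    then show ?thesis
    proof cases
      case zero
      then have "AE x in M. g k x = 0"
        using measK by (simp add: I_def nn_integral_0_iff_AE)
      then have "AE x in M. (\<Prod>j\<in>K. epow (g j x) (w j)) = 0"
        using zero wK[OF zero(1)] K by (elim AE_mp) (auto simp: epow_eq_0_iff intro!: AE_I2)
      then have "(\<integral>\<^sup>+x. (\<Prod>j\<in>K. epow (g j x) (w j)) \<partial>M) = (\<integral>\<^sup>+x. 0 \<partial>M)"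
        by (rule nn_integral_cong_AE)
      then show ?thesis by simp
    next
      case inf
      have "(\<Prod>j\<in>K - {k}. epow (I j) (w j)) \<noteq> 0"
        using inf K by (simp add: epow_eq_0_iff)
      then have "(\<Prod>j\<in>K. epow (I j) (w j)) = top"
        using prod.remove[OF K(2) inf(2), of "\<lambda>j. epow (I j) (w j)"] inf wK[OF inf(2)]
        by (simp add: ennreal_top_mult)
      then show ?thesis by simp
    next
      case fin
      define c where "c j = enn2real (I j)" for j
      have Ic: "I j = ennreal (c j)" "c j > 0" if "j \<in> K" for j
        using fin that by (auto simp: c_def less_top enn2real_positive_iff zero_less_iff_neq_zero)
      have "(\<integral>\<^sup>+x. (\<Prod>j\<in>K. epow (g j x) (w j)) \<partial>M)
         \<le> (\<integral>\<^sup>+x. ennreal (\<Prod>j\<in>K. c j powr w j) * (\<Sum>j\<in>K. ennreal (w j / c j) * g j x) \<partial>M)"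
        by (intro nn_integral_mono epow_prod_le K wK wK1 Ic)
      also have "\<dots> = ennreal (\<Prod>j\<in>K. c j powr w j) * (\<Sum>j\<in>K. ennreal (w j / c j) * I j)"
        using measK by (simp add: nn_integral_cmult nn_integral_sum I_def)
      also have "(\<Sum>j\<in>K. ennreal (w j / c j) * I j) = (\<Sum>j\<in>K. ennreal (w j))"
      proof (intro sum.cong refl)
        fix j assume "j \<in> K"
        then show "ennreal (w j / c j) * I j = ennreal (w j)"
          using Ic[of j] wK[of j] by (simp add: ennreal_mult[symmetric])
      qed
      also have "\<dots> = 1"
        using wK wK1 by (subst sum_ennreal) (auto simp: less_imp_le)
      also have "ennreal (\<Prod>j\<in>K. c j powr w j) * 1 = (\<Prod>j\<in>K. epow (I j) (w j))"
        using Ic wK by (auto simp: prod_ennreal[symmetric] epow_ennreal less_imp_le intro!: prod.cong)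
          (metis epow_ennreal less_imp_le less_numeral_extra(3))
      finally show ?thesis .
    qed
  qed
  then show ?thesis by (simp add: red I_def)
qed

section \<open>Line integrals in all coordinate directions: an inequality of Loomis-Whitney
  type\<close>

lemma measurable_fun_upd_in:
  assumes "j \<in> J"
  shows "(\<lambda>(x, s). x(j := s)) \<in> measurable (Pi\<^sub>M J M \<Otimes>\<^sub>M M j) (Pi\<^sub>M J M)"
  using measurable_add_dim[of j J M] assms by (simp add: insert_absorb)

lemma (in product_sigma_finite) borel_measurable_line_nn_integral:
  assumes f: "f \<in> borel_measurable (Pi\<^sub>M J M)" and j: "j \<in> J"
  shows "(\<lambda>x. \<integral>\<^sup>+s. f (x(j := s)) \<partial>M j) \<in> borel_measurable (Pi\<^sub>M J M)"
proof -
  interpret sigma_finite_measure "M j" by (rule sigma_finite_measures)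
  have "(\<lambda>z. f (case z of (x, s) \<Rightarrow> x(j := s))) \<in> borel_measurable (Pi\<^sub>M J M \<Otimes>\<^sub>M M j)"
    by (rule measurable_compose[OF measurable_fun_upd_in[OF j] f])
  from borel_measurable_nn_integral_fst[OF this] show ?thesis
    unfolding prod.case .
qed

text \<open>For \<open>p = 1 / (card J - 1)\<close> the exponent of \<open>f\<close> vanishes. The general \<open>p\<close> makes the induction on
  \<open>J\<close> work.\<close>

proposition (in product_sigma_finite) nn_integral_grid_lines_le:
  fixes f :: "('i \<Rightarrow> 'a) \<Rightarrow> ennreal"
  assumes "finite J" "p \<ge> 0" "(real (card J) - 1) * p \<le> 1"
    and "f \<in> borel_measurable (Pi\<^sub>M J M)"
  shows "(\<integral>\<^sup>+x. epow (f x) (1 - (real (card J) - 1) * p) *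
      (\<Prod>j\<in>J. epow (\<integral>\<^sup>+t. f (x(j := t)) \<partial>M j) p) \<partial>Pi\<^sub>M J M)
    \<le> epow (\<integral>\<^sup>+x. f x \<partial>Pi\<^sub>M J M) (1 + p)"
  using assms(1,3,4)
proof (induction J arbitrary: f)
  case empty
  then show ?case by (simp add: nn_integral_empty)
next
  case (insert i I)
  let ?J = "insert i I"
  let ?n = "real (card I)"
  note f = insert.prems(2)
  have cJ: "real (card ?J) - 1 = ?n" using insert by simp
  have np: "?n * p \<le> 1" using insert.prems cJ by simp
  then have np': "(?n - 1) * p \<le> 1" using \<open>p \<ge> 0\<close> by (simp add: algebra_simps)
  \<comment> \<open>\<open>F\<close> is \<open>f\<close> with the new coordinate \<open>i\<close>
    integrated out; the induction hypothesis will be applied to it on \<open>I\<close>.\<close>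
  define F where "F x = (\<integral>\<^sup>+t. f (x(i := t)) \<partial>M i)" for x
  have F[measurable]: "F \<in> borel_measurable (Pi\<^sub>M I M)"
  proof -
    interpret sigma_finite_measure "M i" by (rule sigma_finite_measures)
    have "(\<lambda>z. f (case z of (x, s) \<Rightarrow> x(i := s))) \<in> borel_measurable (Pi\<^sub>M I M \<Otimes>\<^sub>M M i)"
      by (rule measurable_compose[OF measurable_add_dim f])
    from borel_measurable_nn_integral_fst[OF this] show ?thesis
      unfolding F_def prod.case .
  qed
  define T where "T j x = (\<integral>\<^sup>+s. f (x(j := s)) \<partial>M j)" for j x
  have T: "T j \<in> borel_measurable (Pi\<^sub>M ?J M)" if "j \<in> ?J" for j
    unfolding T_def using that by (rule borel_measurable_line_nn_integral[OF f])
  \<comment> \<open>The line integral in direction \<open>i\<close> does not depend on the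
    coordinate \<open>i\<close>, so its factor can be taken out of the integral over
    \<open>t\<close>.\<close>
  have Ti: "T i (x(i := t)) = F x" for x t by (simp add: T_def F_def)
  have step: "(\<integral>\<^sup>+t. epow (f (x(i := t))) (1 - ?n * p) * (\<Prod>j\<in>?J. epow (T j (x(i := t))) p) \<partial>M i)
      \<le> epow (F x) (1 - (?n - 1) * p) * (\<Prod>j\<in>I. epow (\<integral>\<^sup>+s. F (x(j := s)) \<partial>M j) p)"
    if x: "x \<in> space (Pi\<^sub>M I M)" for x
  proof -
    have xm[measurable]: "(\<lambda>t. x(i := t)) \<in> measurable (M i) (Pi\<^sub>M ?J M)"
      using x insert.hyps by (intro measurable_component_update)
    have swap: "(\<integral>\<^sup>+t. T j (x(i := t)) \<partial>M i) = (\<integral>\<^sup>+s. F (x(j := s)) \<partial>M j)" if j: "j \<in> I" for j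
    proof -
      interpret pair_sigma_finite "M i" "M j"
        by (simp add: pair_sigma_finite.intro sigma_finite_measures)
      have "(\<lambda>(t, s). f (x(i := t, j := s))) \<in> borel_measurable (M i \<Otimes>\<^sub>M M j)"
      proof -
        have "(\<lambda>z. (x(i := fst z), snd z)) \<in> measurable (M i \<Otimes>\<^sub>M M j) (Pi\<^sub>M ?J M \<Otimes>\<^sub>M M j)"
          by measurable
        from measurable_compose[OF measurable_compose[OF this measurable_fun_upd_in] f] j
        have "(\<lambda>z. f (case (x(i := fst z), snd z) of (y, s) \<Rightarrow> y(j := s)))
            \<in> borel_measurable (M i \<Otimes>\<^sub>M M j)" by blast
        then show ?thesis unfolding split_beta' fst_conv snd_conv .
      qed
      from Fubini'[OF this]
      have "(\<integral>\<^sup>+s. \<integral>\<^sup>+t. f (x(i := t, j := s)) \<partial>M i \<partial>M j)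
        = (\<integral>\<^sup>+t. \<integral>\<^sup>+s. f (x(i := t, j := s)) \<partial>M j \<partial>M i)" .
      moreover have "x(i := t, j := s) = x(j := s, i := t)" for s t
        using j insert.hyps by (intro fun_upd_twist) auto
      ultimately show ?thesis by (simp add: T_def F_def)
    qed
    \<comment> \<open>Hoelder's inequality in \<open>t\<close>: the index \<open>None\<close> stands
      for \<open>f\<close> and \<open>Some j\<close> for the line integral in direction
      \<open>j\<close>. The weight \<open>1 - ?n * p\<close> and the \<open>card I\<close> weights
      \<open>p\<close> add up to 1.\<close>
    define w where "w k = (case k of None \<Rightarrow> 1 - ?n * p | Some j \<Rightarrow> p)" for k :: "'i option"
    define g where "g k t = (case k of None \<Rightarrow> f (x(i := t)) | Some j \<Rightarrow> T j (x(i := t)))"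
      for k :: "'i option" and t
    let ?K = "insert None (Some ` I)"
    have prodK: "(\<Prod>k\<in>?K. h k) = h None * (\<Prod>j\<in>I. h (Some j))" for h :: "'i option \<Rightarrow> ennreal"
      using insert.hyps by (simp add: prod.reindex)
    have "(\<integral>\<^sup>+t. (\<Prod>k\<in>?K. epow (g k t) (w k)) \<partial>M i) \<le> (\<Prod>k\<in>?K. epow (\<integral>\<^sup>+t. g k t \<partial>M i) (w k))"
    proof (rule nn_integral_prod_epow_le)
      show "finite ?K" using insert.hyps by simp
      show "w k \<ge> 0" if "k \<in> ?K" for k
        using np \<open>p \<ge> 0\<close> by (auto simp: w_def split: option.split)
      show "(\<Sum>k\<in>?K. w k) = 1"
        using insert.hyps by (simp add: sum.reindex w_def)
      show "g k \<in> borel_measurable (M i)" if "k \<in> ?K" for k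
      proof (cases k)
        case None
        show ?thesis unfolding g_def None option.case by (rule measurable_compose[OF xm f])
      next
        case (Some j)
        then have "T j \<in> borel_measurable (Pi\<^sub>M ?J M)" using that by (intro T) auto
        then show ?thesis unfolding g_def Some option.case by (rule measurable_compose[OF xm])
      qed
    qed
    moreover have gN: "(\<integral>\<^sup>+t. g None t \<partial>M i) = F x" by (simp add: g_def[abs_def] F_def)
    moreover have gS: "(\<integral>\<^sup>+t. g (Some j) t \<partial>M i) = (\<integral>\<^sup>+s. F (x(j := s)) \<partial>M j)" if "j \<in> I" for j
      using swap[OF that] by (simp add: g_def[abs_def])
    ultimately have hol: "(\<integral>\<^sup>+t. epow (f (x(i := t))) (1 - ?n * p) * (\<Prod>j\<in>I. epow (T j (x(i := t))) p) \<partial>M i)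
      \<le> epow (F x) (1 - ?n * p) * (\<Prod>j\<in>I. epow (\<integral>\<^sup>+s. F (x(j := s)) \<partial>M j) p)"
      unfolding prodK gN by (simp add: w_def g_def[of None] g_def[of "Some _"] gS cong: prod.cong)
    have Tm: "(\<lambda>t. T j (x(i := t))) \<in> borel_measurable (M i)" if "j \<in> I" for j
      by (rule measurable_compose[OF xm T]) (use that in auto)
    have fm: "(\<lambda>t. f (x(i := t))) \<in> borel_measurable (M i)"
      by (rule measurable_compose[OF xm f])
    have "(\<integral>\<^sup>+t. epow (f (x(i := t))) (1 - ?n * p) * (\<Prod>j\<in>?J. epow (T j (x(i := t))) p) \<partial>M i)
      = (\<integral>\<^sup>+t. epow (F x) p * (epow (f (x(i := t))) (1 - ?n * p) * (\<Prod>j\<in>I. epow (T j (x(i := t))) p)) \<partial>M i)"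
      using insert.hyps by (simp add: Ti mult_ac)
    also have "\<dots> = epow (F x) p * (\<integral>\<^sup>+t. epow (f (x(i := t))) (1 - ?n * p) * (\<Prod>j\<in>I. epow (T j (x(i := t))) p) \<partial>M i)"
      by (intro nn_integral_cmult borel_measurable_times_ennreal borel_measurable_prod_ennreal borel_measurable_epow Tm fm)
    also have "\<dots> \<le> epow (F x) p * (epow (F x) (1 - ?n * p) * (\<Prod>j\<in>I. epow (\<integral>\<^sup>+s. F (x(j := s)) \<partial>M j) p))"
      by (intro mult_left_mono hol) simp
    also have "\<dots> = epow (F x) (p + (1 - ?n * p)) * (\<Prod>j\<in>I. epow (\<integral>\<^sup>+s. F (x(j := s)) \<partial>M j) p)"
      using np \<open>p \<ge> 0\<close> by (subst epow_add) (auto simp: mult_ac)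
    \<comment> \<open>The factor taken out in direction \<open>i\<close> raises the exponent of
      \<open>F\<close> by \<open>p\<close>, to exactly the one in the induction hypothesis for
      \<open>I\<close>.\<close>
    also have "p + (1 - ?n * p) = 1 - (?n - 1) * p" by (simp add: algebra_simps)
    finally show ?thesis .
  qed
  have "(\<integral>\<^sup>+x. epow (f x) (1 - (real (card ?J) - 1) * p) * (\<Prod>j\<in>?J. epow (T j x) p) \<partial>Pi\<^sub>M ?J M)
    = (\<integral>\<^sup>+x. \<integral>\<^sup>+t. epow (f (x(i := t))) (1 - ?n * p) * (\<Prod>j\<in>?J. epow (T j (x(i := t))) p) \<partial>M i \<partial>Pi\<^sub>M I M)"
    unfolding cJ using insert.hyps
    by (intro product_nn_integral_insert borel_measurable_times_ennreal borel_measurable_prod_ennreal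
        borel_measurable_epow T f) auto
  also have "\<dots> \<le> (\<integral>\<^sup>+x. epow (F x) (1 - (?n - 1) * p) * (\<Prod>j\<in>I. epow (\<integral>\<^sup>+s. F (x(j := s)) \<partial>M j) p) \<partial>Pi\<^sub>M I M)"
    by (intro nn_integral_mono step)
  also have "\<dots> \<le> epow (\<integral>\<^sup>+x. F x \<partial>Pi\<^sub>M I M) (1 + p)"
    by (intro insert.IH F np')
  also have "(\<integral>\<^sup>+x. F x \<partial>Pi\<^sub>M I M) = (\<integral>\<^sup>+x. f x \<partial>Pi\<^sub>M ?J M)"
    unfolding F_def using insert.hyps by (intro product_nn_integral_insert[symmetric] f)
  finally show ?case unfolding T_def .
qed

section \<open>Integration along coordinate lines\<close>

text \<open>Turns Lebesgue measure into a product measure, so that Fubini applies one coordinate at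
  a time. The update \<open>f(b := t)\<close> moves along the line in direction
  \<open>b\<close>.\<close>

definition of_coords :: "('a \<Rightarrow> real) \<Rightarrow> 'a::euclidean_space" where
  "of_coords f = (\<Sum>b\<in>Basis. f b *\<^sub>R b)"

lemma measurable_of_coords [measurable]: "of_coords \<in> borel_measurable (Pi\<^sub>M Basis (\<lambda>_. lborel))"
  unfolding of_coords_def by measurable

lemma lborel_eq_distr_of_coords: "lborel = distr (\<Pi>\<^sub>M b\<in>Basis. lborel) borel of_coords"
  unfolding of_coords_def[abs_def] by (rule lborel_eq)

lemma of_coords_inner: "c \<in> Basis \<Longrightarrow> of_coords f \<bullet> c = f c"
  by (simp add: of_coords_def inner_sum_left inner_Basis if_distrib sum.delta cong: if_cong)

lemma of_coords_upd:
  assumes "b \<in> Basis"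
  shows "of_coords (f(b := s + t)) = of_coords (f(b := s)) + t *\<^sub>R b"
  by (rule euclidean_eqI) (use assms in \<open>simp add: of_coords_inner inner_add_left inner_Basis\<close>)

lemma AE_lborel_inner_neq:
  fixes b :: "'a::euclidean_space"
  assumes "b \<in> Basis"
  shows "AE x in lborel. x \<bullet> b \<noteq> c"
proof -
  have "{x. x \<bullet> b = c} \<in> null_sets (lebesgue :: 'a measure)"
    using negligible_standard_hyperplane[OF assms, of c] by (simp add: negligible_iff_null_sets)
  moreover have "{x. x \<bullet> b = c} \<in> sets borel"
    by measurable
  ultimately have "{x. x \<bullet> b = c} \<in> null_sets lborel"
    using null_sets_completion_iff[of "{x. x \<bullet> b = c}" lborel] by simp
  then show ?thesis by (rule AE_I') auto
qed

lemma AE_lborel_all_inner_neq: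
  "AE x in lborel. \<forall>b\<in>Basis. x \<bullet> b \<noteq> 0"
  by (subst AE_ball_countable) (auto intro: AE_lborel_inner_neq countable_finite)

text \<open>The fundamental theorem of calculus, started from a point to the left of the support.
  The gauge integral accepts an arbitrary derivative \<open>\<phi>'\<close>; the majorant
  \<open>h\<close> leads back to the Lebesgue integral.\<close>

lemma abs_le_line_nn_integral:
  fixes \<phi> :: "real \<Rightarrow> real"
  assumes deriv: "\<And>t. (\<phi> has_real_derivative \<phi>' t) (at t)"
    and zero: "\<And>t. \<bar>t\<bar> > R \<Longrightarrow> \<phi> t = 0"
    and h[measurable]: "h \<in> borel_measurable borel" and bound: "\<And>t. \<bar>\<phi>' t\<bar> \<le> h t"
  shows "ennreal \<bar>\<phi> s\<bar> \<le> (\<integral>\<^sup>+t. ennreal (h t) \<partial>lborel)"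
proof (cases "(\<integral>\<^sup>+t. ennreal (h t) \<partial>lborel) = top")
  case False
  have h0: "h t \<ge> 0" for t using bound[of t] by linarith
  have hint: "integrable lborel h"
    using False h0 by (intro integrableI_nonneg) (auto simp: less_top)
  define a where "a = min s (- \<bar>R\<bar> - 1)"
  have "(\<phi>' has_integral (\<phi> s - \<phi> a)) {a..s}"
    using deriv by (intro fundamental_theorem_of_calculus)
      (auto simp: a_def has_real_derivative_iff_has_vector_derivative[symmetric] intro: has_field_derivative_at_within)
  moreover have "\<phi> a = 0" by (rule zero) (simp add: a_def)
  ultimately have I: "(\<phi>' has_integral \<phi> s) {a..s}" by simp
  have H: "h integrable_on UNIV" by (rule integrable_on_lborel[OF hint])
  then have H': "h integrable_on {a..s}" by (rule integrable_on_subinterval) auto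
  have "norm (integral {a..s} \<phi>') \<le> integral {a..s} h"
    using I H' bound by (intro Henstock_Kurzweil_Integration.integral_norm_bound_integral) auto
  also have "\<dots> \<le> integral UNIV h"
    using H H' h0 by (intro integral_subset_le) auto
  also have "\<dots> = (\<integral>t. h t \<partial>lborel)" by (rule integral_lborel[OF hint])
  finally have "\<bar>\<phi> s\<bar> \<le> (\<integral>t. h t \<partial>lborel)" using I by (simp add: integral_unique)
  then have "ennreal \<bar>\<phi> s\<bar> \<le> ennreal (\<integral>t. h t \<partial>lborel)" by (rule ennreal_leI)
  also have "\<dots> = (\<integral>\<^sup>+t. ennreal (h t) \<partial>lborel)"
    using hint h0 by (subst nn_integral_eq_integral) auto
  finally show ?thesis .
qed simp

text \<open>Fubini provides integrability on almost every line only. As a non-integrable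
  \<open>\<phi>'\<close> has Bochner integral 0 by convention, the identity can be used on each
  line.\<close>

lemma integral_deriv_eq_0:
  fixes \<phi> :: "real \<Rightarrow> real"
  assumes deriv: "\<And>t. (\<phi> has_real_derivative \<phi>' t) (at t)"
    and zero: "\<And>t. \<bar>t\<bar> > R \<Longrightarrow> \<phi> t = 0"
  shows "(\<integral>t. \<phi>' t \<partial>lborel) = 0"
proof (cases "integrable lborel \<phi>'")
  case True
  define a where "a = \<bar>R\<bar> + 1"
  have zero': "\<phi>' t = 0" if "\<bar>t\<bar> > R" for t
  proof -
    have "open {t::real. R < \<bar>t\<bar>}" by (intro open_Collect_less continuous_intros)
    then have "((\<lambda>_. 0) has_real_derivative \<phi>' t) (at t)"
      using deriv[of t] that zero by (rule_tac has_field_derivative_transform_within_open[of \<phi>]) auto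
    then show ?thesis using DERIV_unique[OF _ DERIV_const] by blast
  qed
  have "(\<phi>' has_integral (\<phi> a - \<phi> (-a))) {-a..a}"
    using deriv by (intro fundamental_theorem_of_calculus)
      (auto simp: a_def has_real_derivative_iff_has_vector_derivative[symmetric] intro: has_field_derivative_at_within)
  moreover have "\<phi> a = 0" "\<phi> (-a) = 0" by (auto intro!: zero simp: a_def)
  ultimately have "(\<phi>' has_integral 0) {-a..a}" by simp
  then have "(\<phi>' has_integral 0) UNIV"
    by (rule has_integral_on_superset) (auto intro!: zero' simp: a_def)
  with has_integral_integral_lborel[OF True] show ?thesis by (rule has_integral_unique)
qed (simp add: not_integrable_integral_eq)

text \<open>Along a line in direction \<open>b\<close> every other coordinate is constant. If one of
  them is nonzero, the line misses the origin, and \<open>g\<close> is differentiable in direction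
  \<open>b\<close> at each of its points.\<close>

lemma line_in_of_coords:
  fixes f :: "'a::euclidean_space \<Rightarrow> real"
  assumes b: "b \<in> Basis" and c: "c \<in> Basis" "c \<noteq> b" "f c \<noteq> 0"
    and deriv: "\<And>x. x \<noteq> 0 \<Longrightarrow> ((\<lambda>t. g (x + t *\<^sub>R b)) has_real_derivative g' x) (at 0)"
    and zero: "\<And>x. norm x > R \<Longrightarrow> g x = 0"
  shows "((\<lambda>t. g (of_coords (f(b := t)))) has_real_derivative g' (of_coords (f(b := t)))) (at t)"
    and "\<bar>t\<bar> > R \<Longrightarrow> g (of_coords (f(b := t))) = 0"
proof -
  have "of_coords (f(b := t)) \<bullet> c \<noteq> 0" using c by (simp add: of_coords_inner)
  then have "of_coords (f(b := t)) \<noteq> 0" by auto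
  from deriv[OF this]
  have "((\<lambda>s. g (of_coords (f(b := t)) + (s - t) *\<^sub>R b)) has_real_derivative g' (of_coords (f(b := t)))) (at (0 + t))"
    using DERIV_shift[of "\<lambda>s. g (of_coords (f(b := t)) + (s - t) *\<^sub>R b)" _ 0 t] by simp
  then show "((\<lambda>t. g (of_coords (f(b := t)))) has_real_derivative g' (of_coords (f(b := t)))) (at t)"
    using of_coords_upd[OF b, of f t, symmetric] by simp
  show "\<bar>t\<bar> > R \<Longrightarrow> g (of_coords (f(b := t))) = 0"
    using Basis_le_norm[OF b, of "of_coords (f(b := t))"] b by (intro zero) (simp add: of_coords_inner)
qed

interpretation lborel_product: product_sigma_finite "\<lambda>_. lborel :: real measure"
  by standard

text \<open>The origin may be singular: in dimension at least two almost every line parallel to a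
  coordinate axis misses it, so no cut-off is needed.\<close>

proposition integral_directional_derivative_eq_0:
  fixes g :: "'a::euclidean_space \<Rightarrow> real"
  assumes dim: "DIM('a) \<ge> 2" and b: "b \<in> Basis"
    and deriv: "\<And>x. x \<noteq> 0 \<Longrightarrow> ((\<lambda>t. g (x + t *\<^sub>R b)) has_real_derivative g' x) (at 0)"
    and zero: "\<And>x. norm x > R \<Longrightarrow> g x = 0"
    and int: "integrable lborel g'"
  shows "(\<integral>x. g' x \<partial>lborel) = 0"
proof -
  obtain c :: 'a where c: "c \<in> Basis" "c \<noteq> b"
  proof -
    have "\<not> Basis \<subseteq> {b}"
      using dim card_mono[of "{b}" "Basis :: 'a set"] by auto
    then show ?thesis using that by auto
  qed
  \<comment> \<open>\<open>k\<close> equals \<open>g'\<close> almost everywhere. It vanishes on the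
    lines with \<open>f c = 0\<close>, among which are all lines through the origin; on the other
    lines \<open>integral_deriv_eq_0\<close> applies.\<close>
  define k where "k x = (if x \<bullet> c = 0 then 0 else g' x)" for x
  have AE: "AE x in lborel. g' x = k x"
    using AE_lborel_inner_neq[OF c(1), of 0] by eventually_elim (simp add: k_def)
  have g'm[measurable]: "g' \<in> borel_measurable borel" using int by (simp add: integrable_iff_bounded)
  have km[measurable]: "k \<in> borel_measurable borel" unfolding k_def by measurable
  have "(\<integral>x. g' x \<partial>lborel) = (\<integral>x. k x \<partial>lborel)"
    using AE by (intro integral_cong_AE) auto
  have kint: "integrable lborel k"
    using int AE by (subst integrable_cong_AE[of k lborel g']) (auto elim: eventually_mono)
  let ?P = "\<lambda>A. Pi\<^sub>M A (\<lambda>_. lborel :: real measure)"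
  have B: "Basis = insert b (Basis - {b})" using b by auto
  have "integrable (distr (?P Basis) borel of_coords) k"
    using kint by (simp add: lborel_eq_distr_of_coords[symmetric])
  then have kint': "integrable (?P Basis) (\<lambda>f. k (of_coords f))"
    by (subst (asm) integrable_distr_eq) auto
  have "(\<integral>x. k x \<partial>lborel) = (\<integral>f. k (of_coords f) \<partial>?P Basis)"
    by (subst lborel_eq_distr_of_coords, subst integral_distr) auto
  also have "\<dots> = (\<integral>f. k (of_coords f) \<partial>?P (insert b (Basis - {b})))"
    using B by simp
  also have "\<dots> = (\<integral>f. \<integral>t. k (of_coords (f(b := t))) \<partial>lborel \<partial>?P (Basis - {b}))"
    using kint' B by (intro lborel_product.product_integral_insert) auto
  also have "\<dots> = (\<integral>f. 0 \<partial>?P (Basis - {b}))"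
  proof (intro Bochner_Integration.integral_cong refl)
    fix f :: "'a \<Rightarrow> real"
    show "(\<integral>t. k (of_coords (f(b := t))) \<partial>lborel) = 0"
    proof (cases "f c = 0")
      case True
      then show ?thesis using c by (simp add: k_def of_coords_inner)
    next
      case False
      then have "k (of_coords (f(b := t))) = g' (of_coords (f(b := t)))" for t
        using c by (simp add: k_def of_coords_inner)
      moreover have "(\<integral>t. g' (of_coords (f(b := t))) \<partial>lborel) = 0"
        by (rule integral_deriv_eq_0[where \<phi> = "\<lambda>t. g (of_coords (f(b := t)))" and R = R])
          (use line_in_of_coords[where f = f and g = g and g' = g' and R = R, OF b c False deriv zero] in auto)
      ultimately show ?thesis by simp
    qed
  qed
  finally show ?thesis using \<open>(\<integral>x. g' x \<partial>lborel) = (\<integral>x. k x \<partial>lborel)\<close> by simp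
qed

text \<open>Each of the n coordinate lines through x bounds |g x| by the integral of
  \<open>h\<close> over that line. The product of these bounds, each raised to the power 1/(n-1), is
  integrated by \<open>nn_integral_grid_lines_le\<close>.\<close>

proposition gagliardo_nirenberg:
  fixes g :: "'a::euclidean_space \<Rightarrow> real"
  defines "n \<equiv> real DIM('a)"
  assumes dim: "DIM('a) \<ge> 2"
    and gm[measurable]: "g \<in> borel_measurable borel"
    and deriv: "\<And>b x. b \<in> Basis \<Longrightarrow> x \<noteq> 0 \<Longrightarrow> ((\<lambda>t. g (x + t *\<^sub>R b)) has_real_derivative g' b x) (at 0)"
    and zero: "\<And>x. norm x > R \<Longrightarrow> g x = 0"
    and int: "integrable lborel h"
    and bound: "\<And>b x. b \<in> Basis \<Longrightarrow> x \<noteq> 0 \<Longrightarrow> \<bar>g' b x\<bar> \<le> h x" and h0: "h 0 \<ge> 0"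
  shows "(\<integral>\<^sup>+x. ennreal (\<bar>g x\<bar> powr (n / (n - 1))) \<partial>lborel) \<le> ennreal ((\<integral>x. h x \<partial>lborel) powr (n / (n - 1)))"
proof -
  define p where "p = 1 / (n - 1)"
  have n: "n \<ge> 2" using dim by (simp add: n_def)
  have p: "p > 0" "1 - (n - 1) * p = 0" "n * p = n / (n - 1)" "1 + p = n / (n - 1)"
    using n by (auto simp: p_def field_simps)
  have hm[measurable]: "h \<in> borel_measurable borel" using int by (simp add: integrable_iff_bounded)
  have hn: "h x \<ge> 0" for x
  proof (cases "x = 0")
    case False
    obtain b :: 'a where "b \<in> Basis" using nonempty_Basis by blast
    from bound[OF this False] show ?thesis by linarith
  qed (simp add: h0)
  let ?P = "\<lambda>A. Pi\<^sub>M A (\<lambda>_. lborel :: real measure)"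
  define F where "F f = ennreal (h (of_coords f))" for f
  have Fm: "F \<in> borel_measurable (?P Basis)" unfolding F_def by measurable
  \<comment> \<open>Replacing |g| by 0 on the coordinate hyperplanes, a null set, makes the line
    bound valid at every point: off them no coordinate line through the point meets the
    origin.\<close>
  define G where "G f = (if \<forall>b\<in>Basis. of_coords f \<bullet> b \<noteq> 0 then \<bar>g (of_coords f)\<bar> else 0)" for f :: "'a \<Rightarrow> real"
  have pt: "ennreal (G f) \<le> (\<integral>\<^sup>+t. F (f(b := t)) \<partial>lborel)" if f: "f \<in> space (?P Basis)" and b: "b \<in> Basis" for f b
  proof (cases "\<forall>b\<in>(Basis :: 'a set). of_coords f \<bullet> b \<noteq> 0")
    case True
    obtain c :: 'a where c: "c \<in> Basis" "c \<noteq> b"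
    proof -
      have "\<not> Basis \<subseteq> {b}"
        using dim card_mono[of "{b}" "Basis :: 'a set"] by auto
      then show ?thesis using that by auto
    qed
    have fc: "f c \<noteq> 0" using True c by (auto simp: of_coords_inner)
    note L = line_in_of_coords[where f = f and g = g and g' = "g' b" and R = R, OF b c fc deriv[OF b] zero]
    have nz: "of_coords (f(b := t)) \<noteq> 0" for t
    proof
      assume "of_coords (f(b := t)) = 0"
      moreover have "of_coords (f(b := t)) \<bullet> c \<noteq> 0" using c fc by (simp add: of_coords_inner)
      ultimately show False by simp
    qed
    have "(\<lambda>t. h (of_coords (f(b := t)))) = (\<lambda>t. h (of_coords (f(b := 0)) + t *\<^sub>R b))"
      using of_coords_upd[OF b, of f 0 t for t] by (metis add_0)
    then have [measurable]: "(\<lambda>t. h (of_coords (f(b := t)))) \<in> borel_measurable borel"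
      by (simp only:) measurable
    have "ennreal \<bar>g (of_coords (f(b := f b)))\<bar> \<le> (\<integral>\<^sup>+t. ennreal (h (of_coords (f(b := t)))) \<partial>lborel)"
      by (rule abs_le_line_nn_integral[where \<phi> = "\<lambda>t. g (of_coords (f(b := t)))" and R = R])
        (use L bound[OF b nz] in auto)
    then show ?thesis using True by (simp add: G_def F_def)
  qed (auto simp: G_def)
  have "(\<integral>\<^sup>+x. ennreal (\<bar>g x\<bar> powr (n / (n - 1))) \<partial>lborel)
     = (\<integral>\<^sup>+x. ennreal ((if \<forall>b\<in>Basis. x \<bullet> b \<noteq> 0 then \<bar>g x\<bar> else 0) powr (n / (n - 1))) \<partial>lborel)"
    by (intro nn_integral_cong_AE) (use AE_lborel_all_inner_neq in eventually_elim, simp)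
  also have "\<dots> = (\<integral>\<^sup>+f. ennreal (G f powr (n / (n - 1))) \<partial>?P Basis)"
    unfolding G_def by (subst lborel_eq_distr_of_coords, subst nn_integral_distr) auto
  \<comment> \<open>For this \<open>p\<close> the exponent of \<open>F f\<close> is 0, so that
    factor is 1, even where \<open>F f = 0\<close>.\<close>
  also have "\<dots> \<le> (\<integral>\<^sup>+f. epow (F f) (1 - (real (card (Basis :: 'a set)) - 1) * p)
       * (\<Prod>b\<in>Basis. epow (\<integral>\<^sup>+t. F (f(b := t)) \<partial>lborel) p) \<partial>?P Basis)"
  proof (intro nn_integral_mono)
    fix f :: "'a \<Rightarrow> real" assume f: "f \<in> space (?P Basis)"
    have G0: "G f \<ge> 0" by (simp add: G_def)
    have "G f powr (n / (n - 1)) = (G f powr p) ^ DIM('a)"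
      unfolding p(3)[symmetric] using powr_realpow'[of "G f powr p" "DIM('a)"]
      by (simp add: powr_powr n_def mult.commute)
    then have "ennreal (G f powr (n / (n - 1))) = (\<Prod>b\<in>(Basis :: 'a set). epow (ennreal (G f)) p)"
      using p(1) G0 by (simp add: epow_ennreal ennreal_power)
    also have "\<dots> \<le> (\<Prod>b\<in>Basis. epow (\<integral>\<^sup>+t. F (f(b := t)) \<partial>lborel) p)"
      using p(1) by (intro prod_mono_ennreal epow_mono pt f) auto
    finally show "ennreal (G f powr (n / (n - 1))) \<le> epow (F f) (1 - (real (card (Basis :: 'a set)) - 1) * p)
       * (\<Prod>b\<in>Basis. epow (\<integral>\<^sup>+t. F (f(b := t)) \<partial>lborel) p)"
      using p(2) by (simp add: n_def)
  qed
  also have "\<dots> \<le> epow (\<integral>\<^sup>+f. F f \<partial>?P Basis) (1 + p)"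
    using p by (intro lborel_product.nn_integral_grid_lines_le Fm) (auto simp: n_def)
  also have "(\<integral>\<^sup>+f. F f \<partial>?P Basis) = (\<integral>\<^sup>+x. ennreal (h x) \<partial>lborel)"
    unfolding F_def by (subst (2) lborel_eq_distr_of_coords, subst nn_integral_distr) auto
  also have "\<dots> = ennreal (\<integral>x. h x \<partial>lborel)"
    using int hn by (intro nn_integral_eq_integral) auto
  also have "epow \<dots> (1 + p) = ennreal ((\<integral>x. h x \<partial>lborel) powr (n / (n - 1)))"
    using p hn by (subst epow_ennreal) auto
  finally show ?thesis .
qed

section \<open>Power weights\<close>

lemma nn_integral_abs_powr_finite:
  assumes s: "s > -1" and R: "R \<ge> 0"
  shows "(\<integral>\<^sup>+t. ennreal (\<bar>t\<bar> powr s * indicator {-R..R} t) \<partial>lborel) < top"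
proof -
  have "((\<lambda>t. t powr s) has_integral (R powr (s + 1) / (s + 1))) {0..R}"
    by (rule has_integral_powr_from_0[OF s R])
  then have I: "((\<lambda>t. \<bar>t\<bar> powr s) has_integral (R powr (s + 1) / (s + 1))) {0..R}"
    by (rule has_integral_eq[rotated]) simp
  then have "((\<lambda>t. \<bar>- t\<bar> powr s) has_integral (R powr (s + 1) / (s + 1))) {-R..-0}"
    by (subst has_integral_reflect_real) simp
  then have "((\<lambda>t. \<bar>t\<bar> powr s) has_integral (R powr (s + 1) / (s + 1) + R powr (s + 1) / (s + 1))) {-R..R}"
    using I R by (intro has_integral_combine[of "-R" 0 R]) auto
  then show ?thesis
    using nn_integral_has_integral_lebesgue'[of "{-R..R}" "\<lambda>t. \<bar>t\<bar> powr s"]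
    by (simp add: ennreal_mult ennreal_indicator)
qed

text \<open>For negative \<gamma>, the bounds |x \<bullet> b| \<le> |x| show that |x|^\<gamma> is at
  most the product of the |x \<bullet> b|^(\<gamma>/n). Over a cube containing the ball, its
  integral splits into one-dimensional ones with exponent \<gamma>/n > -1.\<close>

lemma integrable_norm_powr_cball:
  assumes \<gamma>: "\<gamma> > - real DIM('a::euclidean_space)"
  shows "integrable lborel (\<lambda>x::'a. norm x powr \<gamma> * indicator (cball 0 R) x)"
proof (cases "\<gamma> \<ge> 0")
  case True
  have "integrable lborel (\<lambda>x::'a. R powr \<gamma> * indicator (cball 0 R) x)"
    by (intro integrable_mult_right integrable_real_indicator) (use emeasure_bounded_finite[OF bounded_cball, of 0 R] in auto)
  then show ?thesis
    by (rule Bochner_Integration.integrable_bound)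
      (auto simp: indicator_def True intro!: powr_mono2)
next
  case False
  define n where "n = real DIM('a)"
  define s where "s = \<gamma> / n"
  have n: "n > 0" by (simp add: n_def)
  have s: "s > -1" "s < 0" "s * n = \<gamma>" using False \<gamma> n by (auto simp: s_def field_simps n_def[symmetric])
  show ?thesis
  proof (cases "R \<ge> 0")
    case R: True
    have le: "ennreal (norm x powr \<gamma> * indicator (cball 0 R) x)
        \<le> ennreal (\<Prod>b\<in>Basis. \<bar>x \<bullet> b\<bar> powr s * indicator {-R..R} (x \<bullet> b))"
      if x: "\<forall>b\<in>Basis. x \<bullet> b \<noteq> 0" for x :: 'a
    proof (cases "norm x \<le> R")
      case True
      have ind: "x \<bullet> b \<in> {-R..R}" if "b \<in> Basis" for b
        using Basis_le_norm[OF that, of x] True by auto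
      have "norm x powr \<gamma> = (\<Prod>b\<in>(Basis::'a set). norm x powr s)"
        unfolding s(3)[symmetric] using powr_realpow'[of "norm x powr s" "DIM('a)"]
        by (simp add: powr_powr n_def)
      also have "\<dots> \<le> (\<Prod>b\<in>Basis. \<bar>x \<bullet> b\<bar> powr s)"
        using x s(2) by (intro prod_mono conjI powr_mono2' Basis_le_norm) auto
      finally show ?thesis using ind True by (auto intro!: ennreal_leI)
    qed auto
    have "(\<integral>\<^sup>+(x::'a). ennreal (norm x powr \<gamma> * indicator (cball 0 R) x) \<partial>lborel)
      \<le> (\<integral>\<^sup>+(x::'a). ennreal (\<Prod>b\<in>Basis. \<bar>x \<bullet> b\<bar> powr s * indicator {-R..R} (x \<bullet> b)) \<partial>lborel)"
      by (intro nn_integral_mono_AE) (rule eventually_mono[OF AE_lborel_all_inner_neq], rule le)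
    also have "\<dots> = (\<integral>\<^sup>+(x::'a). (\<Prod>b\<in>Basis. ennreal (\<bar>x \<bullet> b\<bar> powr s * indicator {-R..R} (x \<bullet> b))) \<partial>lborel)"
      by (intro nn_integral_cong prod_ennreal[symmetric]) auto
    also have "\<dots> = (\<Prod>b\<in>(Basis::'a set). (\<integral>\<^sup>+t. ennreal (\<bar>t\<bar> powr s * indicator {-R..R} t) \<partial>lborel))"
      by (subst nn_integral_lborel_prod[symmetric]) auto
    also have "\<dots> < top"
      using nn_integral_abs_powr_finite[OF s(1) R] by (simp add: power_less_top_ennreal)
    finally have fin: "(\<integral>\<^sup>+(x::'a). ennreal (norm x powr \<gamma> * indicator (cball 0 R) x) \<partial>lborel) < top" .
    have [measurable]: "cball (0::'a) R \<in> sets borel" by simp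
    have "(\<lambda>x::'a. norm x powr \<gamma> * indicator (cball 0 R) x) \<in> borel_measurable lborel" by measurable
    then show ?thesis
      using fin by (intro integrableI_nonneg) auto
  qed (auto simp: not_le indicator_def)
qed

text \<open>The integrability criterion behind the weighted integrals below. Since
  \<open>0 powr \<gamma> = 0\<close>, the bound forces \<open>f 0 = 0\<close>, which holds for
  integrands that carry a power of |x| as a factor.\<close>

lemma integrable_bound_norm_powr:
  fixes f :: "'a::euclidean_space \<Rightarrow> real"
  assumes \<gamma>: "\<gamma> > - real DIM('a)" and f: "f \<in> borel_measurable borel"
    and bound: "\<And>x. \<bar>f x\<bar> \<le> C * norm x powr \<gamma>" and zero: "\<And>x. norm x > R \<Longrightarrow> f x = 0"
  shows "integrable lborel f"
proof (rule Bochner_Integration.integrable_bound)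
  show "integrable lborel (\<lambda>x::'a. C * (norm x powr \<gamma> * indicator (cball 0 R) x))"
    by (intro integrable_mult_right integrable_norm_powr_cball \<gamma>)
  show "AE x in lborel. norm (f x) \<le> norm (C * (norm x powr \<gamma> * indicator (cball 0 R) x))"
  proof (intro AE_I2)
    fix x :: 'a
    have "\<bar>f x\<bar> \<le> \<bar>C * norm x powr \<gamma>\<bar>" using bound[of x] by linarith
    then show "norm (f x) \<le> norm (C * (norm x powr \<gamma> * indicator (cball 0 R) x))"
      using zero[of x] by (auto simp: indicator_def)
  qed
qed (use f in simp)

text \<open>Hoelder's inequality, by Young's inequality after normalising \<open>f\<close> and
  \<open>g\<close>. The endpoints l = 0 and l = 1 are included, and \<open>h\<close> may be
  negative.\<close>

lemma integral_powr_interpolation: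
  fixes f g h :: "'a \<Rightarrow> real"
  assumes int: "integrable M f" "integrable M g" "integrable M h"
    and nonneg: "\<And>x. f x \<ge> 0" "\<And>x. g x \<ge> 0" and l: "0 \<le> l" "l \<le> 1"
    and le: "\<And>x. h x \<le> f x powr l * g x powr (1 - l)"
  shows "(\<integral>x. h x \<partial>M) \<le> (\<integral>x. f x \<partial>M) powr l * (\<integral>x. g x \<partial>M) powr (1 - l)"
proof -
  define F where "F = (\<integral>x. f x \<partial>M)"
  define G where "G = (\<integral>x. g x \<partial>M)"
  have FG: "F \<ge> 0" "G \<ge> 0" using nonneg by (auto simp: F_def G_def)
  show ?thesis
  proof (cases "F = 0 \<or> G = 0")
    \<comment> \<open>Here \<open>h\<close> is at most 0 almost everywhere. By the convention
      \<open>0 powr 0 = 0\<close> the right-hand side is 0 at the endpoint exponents as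
      well.\<close>
    case True
    then have "(AE x in M. f x = 0) \<or> (AE x in M. g x = 0)"
      using int nonneg by (auto simp: F_def G_def integral_nonneg_eq_0_iff_AE)
    then have "AE x in M. h x \<le> 0"
    proof
      assume "AE x in M. f x = 0"
      then show ?thesis by eventually_elim (use le in \<open>metis mult_zero_left powr_0 powr_zero_eq_one\<close>)
    next
      assume "AE x in M. g x = 0"
      then show ?thesis by eventually_elim (use le in \<open>metis mult_zero_right powr_0 powr_zero_eq_one\<close>)
    qed
    then have "(\<integral>x. h x \<partial>M) \<le> (\<integral>x. 0 \<partial>M)"
      using int by (intro integral_mono_AE) auto
    then show ?thesis using True by (auto simp: F_def G_def)
  next
    case False
    then have pos: "F > 0" "G > 0" using FG by auto
    have pt: "h x \<le> F powr l * G powr (1 - l) * (l * (f x / F) + (1 - l) * (g x / G))" for x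
    proof (cases "f x = 0 \<or> g x = 0")
      case True
      have "h x \<le> 0" using le[of x] True by auto
      also have "0 \<le> F powr l * G powr (1 - l) * (l * (f x / F) + (1 - l) * (g x / G))"
        using pos l nonneg[of x] by (intro mult_nonneg_nonneg add_nonneg_nonneg) auto
      finally show ?thesis .
    next
      case False
      then have fg: "f x > 0" "g x > 0" using nonneg[of x] by auto
      have "h x \<le> f x powr l * g x powr (1 - l)" by (rule le)
      also have "\<dots> = F powr l * G powr (1 - l) * ((f x / F) powr l * (g x / G) powr (1 - l))"
        using pos fg by (simp add: powr_divide)
      also have "\<dots> \<le> F powr l * G powr (1 - l) * (l * (f x / F) + (1 - l) * (g x / G))"
        using pos fg l by (intro mult_left_mono Youngs_inequality_0) auto
      finally show ?thesis .
    qed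
    have "(\<integral>x. h x \<partial>M) \<le> (\<integral>x. F powr l * G powr (1 - l) * (l * (f x / F) + (1 - l) * (g x / G)) \<partial>M)"
      using int by (intro integral_mono pt) auto
    also have "\<dots> = F powr l * G powr (1 - l) * (l * (F / F) + (1 - l) * (G / G))"
      using int by (simp add: F_def G_def)
    also have "\<dots> = F powr l * G powr (1 - l)" using pos by simp
    finally show ?thesis by (simp add: F_def G_def)
  qed
qed

corollary integral_Cauchy_Schwarz:
  fixes f g h :: "'a \<Rightarrow> real"
  assumes int: "integrable M f" "integrable M g" "integrable M h"
    and nonneg: "\<And>x. f x \<ge> 0" "\<And>x. g x \<ge> 0"
    and le: "\<And>x. h x \<le> sqrt (f x * g x)"
  shows "(\<integral>x. h x \<partial>M) \<le> sqrt ((\<integral>x. f x \<partial>M) * (\<integral>x. g x \<partial>M))"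
proof -
  have "(\<integral>x. h x \<partial>M) \<le> (\<integral>x. f x \<partial>M) powr (1/2) * (\<integral>x. g x \<partial>M) powr (1 - 1/2)"
  proof (rule integral_powr_interpolation[OF int nonneg])
    show "h x \<le> f x powr (1/2) * g x powr (1 - 1/2)" for x
      using le[of x] nonneg[of x] by (simp add: powr_half_sqrt real_sqrt_mult)
  qed auto
  also have "\<dots> = sqrt ((\<integral>x. f x \<partial>M) * (\<integral>x. g x \<partial>M))"
    using nonneg by (simp add: powr_half_sqrt real_sqrt_mult)
  finally show ?thesis .
qed

section \<open>Derivatives of powers of absolute values and norms\<close>

lemma has_real_derivative_0_if_le_powr:
  fixes f :: "real \<Rightarrow> real"
  assumes m: "m > 1" and le: "\<And>y. \<bar>f y\<bar> \<le> \<bar>y\<bar> powr m"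
  shows "(f has_real_derivative 0) (at 0)"
proof -
  have f0: "f 0 = 0" using le[of 0] m by simp
  have "((\<lambda>h. (f (0 + h) - f 0) / h) \<longlongrightarrow> 0) (at 0)"
  proof (rule Lim_null_comparison)
    have "((\<lambda>h::real. \<bar>h\<bar>) \<longlongrightarrow> \<bar>0\<bar>) (at 0)" by (intro tendsto_intros)
    then have "((\<lambda>h::real. \<bar>h\<bar> powr (m - 1)) \<longlongrightarrow> 0 powr (m - 1)) (at 0)"
      using m by (intro tendsto_powr2) (auto intro: tendsto_intros)
    then show "((\<lambda>h::real. \<bar>h\<bar> powr (m - 1)) \<longlongrightarrow> 0) (at 0)" using m by simp
    show "\<forall>\<^sub>F h in at 0. norm ((f (0 + h) - f 0) / h) \<le> \<bar>h\<bar> powr (m - 1)"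
    proof (rule eventually_at_topological[THEN iffD2], intro exI[of _ UNIV] conjI ballI impI)
      fix h :: real assume "h \<noteq> 0"
      then show "norm ((f (0 + h) - f 0) / h) \<le> \<bar>h\<bar> powr (m - 1)"
        using le[of h] by (simp add: f0 abs_divide powr_diff divide_right_mono)
    qed auto
  qed
  then show ?thesis by (simp add: DERIV_def)
qed

lemma has_real_derivative_abs_powr:
  assumes m: "m > 1"
  shows "((\<lambda>y::real. \<bar>y\<bar> powr m) has_real_derivative m * \<bar>y\<bar> powr (m - 1) * sgn y) (at y)"
proof (cases "y = 0")
  case True
  then show ?thesis using has_real_derivative_0_if_le_powr[OF m, of "\<lambda>y. \<bar>y\<bar> powr m"] by simp
next
  case False
  then have "((\<lambda>y. \<bar>y\<bar>) has_real_derivative sgn y) (at y)"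
  proof (cases "y > 0")
    case True
    then show ?thesis
      by (intro has_field_derivative_transform_within_open[OF DERIV_ident, of "{0<..}", THEN DERIV_cong]) auto
  next
    case False
    with \<open>y \<noteq> 0\<close> show ?thesis
      by (intro has_field_derivative_transform_within_open[OF DERIV_minus[OF DERIV_ident], of "{..<0}", THEN DERIV_cong]) auto
  qed
  then show ?thesis
    using False by (auto intro!: derivative_eq_intros simp: powr_diff field_simps)
qed

text \<open>For m = 1 the function is the identity, whose derivative is 1 also at 0, where
  \<open>m * \<bar>y\<bar> powr (m - 1)\<close> would be 0. This case corresponds to q = 2 in
  \<open>energy_le\<close>.\<close>

lemma has_real_derivative_sgn_abs_powr:
  assumes m: "m \<ge> 1"
  shows "((\<lambda>y::real. sgn y * \<bar>y\<bar> powr m) has_real_derivative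
    (if m = 1 then 1 else m * \<bar>y\<bar> powr (m - 1))) (at y)"
proof -
  consider "m = 1" | "m > 1" "y = 0" | "m > 1" "y \<noteq> 0" using m by linarith
  then show ?thesis
  proof cases
    case 1
    then have "(\<lambda>y::real. sgn y * \<bar>y\<bar> powr m) = (\<lambda>y. y)"
      by (auto simp: sgn_if)
    with 1 show ?thesis by simp
  next
    case 2
    have "\<bar>sgn y * \<bar>y\<bar> powr m\<bar> \<le> \<bar>y\<bar> powr m" for y :: real
      by (simp add: sgn_if abs_mult)
    from has_real_derivative_0_if_le_powr[OF 2(1) this] show ?thesis using 2 by simp
  next
    case 3
    \<comment> \<open>Near y the sign is constant, so it is frozen at \<open>sgn y\<close>
      first.\<close>
    have "((\<lambda>z. sgn y * \<bar>z\<bar> powr m) has_real_derivative sgn y * (m * \<bar>y\<bar> powr (m - 1) * sgn y)) (at y)"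
      by (intro DERIV_cmult has_real_derivative_abs_powr 3)
    moreover have "\<forall>\<^sub>F z in nhds y. sgn z = sgn y"
    proof (cases "y > 0")
      case True
      have "open {0::real<..}" by simp
      then have "\<forall>\<^sub>F z in nhds y. z \<in> {0<..}" using True by (intro eventually_nhds_in_open) auto
      then show ?thesis using True by (auto elim!: eventually_mono)
    next
      case False
      have "open {..<0::real}" by simp
      then have "\<forall>\<^sub>F z in nhds y. z \<in> {..<0}" using False 3 by (intro eventually_nhds_in_open) auto
      then show ?thesis using False 3 by (auto elim!: eventually_mono)
    qed
    ultimately have "((\<lambda>z. sgn z * \<bar>z\<bar> powr m) has_real_derivative sgn y * (m * \<bar>y\<bar> powr (m - 1) * sgn y)) (at y)"
      by (subst DERIV_cong_ev[OF refl _ refl]) (auto elim: eventually_mono)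
    moreover have "sgn y * (m * \<bar>y\<bar> powr (m - 1) * sgn y) = m * \<bar>y\<bar> powr (m - 1)"
      using 3 by (simp add: sgn_if)
    ultimately show ?thesis using 3 by simp
  qed
qed

text \<open>Along the line |x|^a is the power a/2 of the quadratic polynomial x \<bullet> x, which
  is positive at t = 0.\<close>

lemma has_real_derivative_norm_powr_line:
  fixes x :: "'a::euclidean_space"
  assumes "x \<noteq> 0"
  shows "((\<lambda>t. norm (x + t *\<^sub>R b) powr a) has_real_derivative a * norm x powr (a - 2) * (x \<bullet> b)) (at 0)"
proof -
  have "((\<lambda>t. (x + t *\<^sub>R b) \<bullet> (x + t *\<^sub>R b)) has_real_derivative 2 * (x \<bullet> b)) (at 0)"
    unfolding inner_add_left inner_add_right inner_scaleR_left inner_scaleR_right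
    by (auto intro!: derivative_eq_intros simp: inner_commute)
  then have "((\<lambda>t. ((x + t *\<^sub>R b) \<bullet> (x + t *\<^sub>R b)) powr (a / 2)) has_real_derivative
      (a / 2) * (x \<bullet> x) powr (a / 2 - 1) * (2 * (x \<bullet> b))) (at 0)"
    using assms by (auto intro!: derivative_eq_intros simp: powr_diff field_simps)
  moreover have "(y \<bullet> y) powr s = norm y powr (2 * s)" for y :: 'a and s
    by (simp add: power2_norm_eq_inner[symmetric] powr_powr[symmetric] powr_numeral)
  ultimately show ?thesis by (simp add: mult.commute mult.left_commute right_diff_distrib)
qed

section \<open>Weighted Hardy and Sobolev inequalities\<close>

lemma powr_mult_eq_square: "a + b = 2 * c \<Longrightarrow> (x::real) powr a * x powr b = (x powr c)\<^sup>2"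
  by (metis mult_2 power2_eq_square powr_add)

lemma has_real_derivative_abs_powr_compose:
  assumes "(v has_real_derivative v') (at t)" "m > 1"
  shows "((\<lambda>t. \<bar>v t\<bar> powr m) has_real_derivative m * \<bar>v t\<bar> powr (m - 1) * sgn (v t) * v') (at t)"
  by (rule DERIV_chain2[OF has_real_derivative_abs_powr[OF assms(2)] assms(1)])

text \<open>The first-order estimates use only derivatives along the axes, uniform bounds and a
  bounded support. One constant \<open>C\<close> bounds both the function and its gradient
  \<open>G\<close>.\<close>

locale bounded_support_gradient =
  fixes u :: "'a::euclidean_space \<Rightarrow> real" and G :: "'a \<Rightarrow> 'a" and R C :: real
  assumes u_deriv: "\<And>b x. b \<in> Basis \<Longrightarrow> ((\<lambda>t. u (x + t *\<^sub>R b)) has_real_derivative G x \<bullet> b) (at 0)"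
    and u_meas [measurable]: "u \<in> borel_measurable borel"
    and G_meas [measurable]: "G \<in> borel_measurable borel"
    and u_bound: "\<And>x. \<bar>u x\<bar> \<le> C" and G_bound: "\<And>x. norm (G x) \<le> C"
    and u_zero: "\<And>x. norm x > R \<Longrightarrow> u x = 0"
    and dim: "DIM('a) > 2"
begin

definition n :: real where "n = real DIM('a)"

lemma n_gt: "n > 2"
  using dim by (simp add: n_def)

lemma integrable_weighted:
  assumes \<gamma>: "\<gamma> > - n" and m: "m \<ge> 0"
    and k: "k \<in> borel_measurable borel" and k_bound: "\<And>x. \<bar>k x\<bar> \<le> K"
  shows "integrable lborel (\<lambda>x. norm x powr \<gamma> * (\<bar>u x\<bar> powr m * k x))"
proof (rule integrable_bound_norm_powr)
  note [measurable] = k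
  show "(\<lambda>x. norm x powr \<gamma> * (\<bar>u x\<bar> powr m * k x)) \<in> borel_measurable borel" by measurable
  fix x
  have "\<bar>\<bar>u x\<bar> powr m * k x\<bar> \<le> C powr m * K"
    unfolding abs_mult using u_bound[of x] m k_bound[of x] by (intro mult_mono) (auto intro: powr_mono2)
  then show "\<bar>norm x powr \<gamma> * (\<bar>u x\<bar> powr m * k x)\<bar> \<le> (C powr m * K) * norm x powr \<gamma>"
    by (simp add: abs_mult mult.commute mult_left_mono)
qed (use \<gamma> u_zero in \<open>auto simp: n_def\<close>)

lemma integrable_weighted_powr:
  "\<gamma> > - n \<Longrightarrow> m \<ge> 0 \<Longrightarrow> integrable lborel (\<lambda>x. norm x powr \<gamma> * \<bar>u x\<bar> powr m)"
  using integrable_weighted[of \<gamma> m "\<lambda>_. 1" 1] by simp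

lemma integrable_weighted_gradient:
  "\<gamma> > - n \<Longrightarrow> m \<ge> 0 \<Longrightarrow> integrable lborel (\<lambda>x. norm x powr \<gamma> * (\<bar>u x\<bar> powr m * norm (G x)))"
  by (rule integrable_weighted[where K = C]) (use G_bound in auto)

text \<open>Formally 4/q^2 times the weighted Dirichlet energy of |u|^(q/2). For q = 2 the
  convention \<open>0 powr 0 = 0\<close> removes the zero set of u from the integral.\<close>

definition energy :: "real \<Rightarrow> real \<Rightarrow> real" where
  "energy \<alpha> q = (\<integral>x. norm x powr \<alpha> * (\<bar>u x\<bar> powr (q - 2) * (norm (G x))\<^sup>2) \<partial>lborel)"

definition moment :: "real \<Rightarrow> real \<Rightarrow> real" where
  "moment \<gamma> m = (\<integral>x. norm x powr \<gamma> * \<bar>u x\<bar> powr m \<partial>lborel)"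

lemma integrable_energy:
  "\<alpha> > - n \<Longrightarrow> q \<ge> 2 \<Longrightarrow> integrable lborel (\<lambda>x. norm x powr \<alpha> * (\<bar>u x\<bar> powr (q - 2) * (norm (G x))\<^sup>2))"
  by (rule integrable_weighted[where K = "C\<^sup>2"]) (use G_bound in \<open>auto intro: power_mono\<close>)

lemma energy_nonneg: "energy \<alpha> q \<ge> 0"
  by (simp add: energy_def)

lemma moment_nonneg: "moment \<gamma> m \<ge> 0"
  by (simp add: moment_def)

text \<open>The exponents \<delta> and l are means of those in the energy and the moment, so the
  left integrand is pointwise the geometric mean of the other two.
  \<open>moment_Cauchy_Schwarz\<close> follows the same pattern.\<close>

lemma gradient_Cauchy_Schwarz:
  assumes "\<alpha> > - n" "q \<ge> 2" "\<gamma> > - n" "m \<ge> 0" "\<delta> > - n" "l \<ge> 0"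
    and "\<alpha> + \<gamma> = 2 * \<delta>" "q - 2 + m = 2 * l"
  shows "(\<integral>x. norm x powr \<delta> * (\<bar>u x\<bar> powr l * norm (G x)) \<partial>lborel) \<le> sqrt (energy \<alpha> q * moment \<gamma> m)"
  unfolding energy_def moment_def
proof (rule integral_Cauchy_Schwarz)
  fix x
  have "(norm x powr \<alpha> * (\<bar>u x\<bar> powr (q - 2) * (norm (G x))\<^sup>2)) * (norm x powr \<gamma> * \<bar>u x\<bar> powr m)
    = (norm x powr \<alpha> * norm x powr \<gamma>) * (\<bar>u x\<bar> powr (q - 2) * \<bar>u x\<bar> powr m) * (norm (G x))\<^sup>2"
    by (simp only: mult_ac)
  also have "\<dots> = (norm x powr \<delta> * (\<bar>u x\<bar> powr l * norm (G x)))\<^sup>2"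
    using assms by (simp add: powr_mult_eq_square[of \<alpha> \<gamma> \<delta>] powr_mult_eq_square[of "q - 2" m l] power_mult_distrib)
  finally show "norm x powr \<delta> * (\<bar>u x\<bar> powr l * norm (G x)) \<le>
     sqrt ((norm x powr \<alpha> * (\<bar>u x\<bar> powr (q - 2) * (norm (G x))\<^sup>2)) * (norm x powr \<gamma> * \<bar>u x\<bar> powr m))"
    by simp
qed (use assms in \<open>auto intro: integrable_energy integrable_weighted_powr integrable_weighted_gradient\<close>)

lemma moment_Cauchy_Schwarz:
  assumes "\<alpha> > - n" "q \<ge> 0" "\<gamma> > - n" "m \<ge> 0" "\<delta> > - n" "l \<ge> 0"
    and "\<alpha> + \<gamma> = 2 * \<delta>" "q + m = 2 * l"
  shows "moment \<delta> l \<le> sqrt (moment \<alpha> q * moment \<gamma> m)"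
  unfolding moment_def
proof (rule integral_Cauchy_Schwarz)
  fix x
  have "(norm x powr \<alpha> * \<bar>u x\<bar> powr q) * (norm x powr \<gamma> * \<bar>u x\<bar> powr m)
    = (norm x powr \<alpha> * norm x powr \<gamma>) * (\<bar>u x\<bar> powr q * \<bar>u x\<bar> powr m)"
    by (simp only: mult_ac)
  also have "\<dots> = (norm x powr \<delta> * \<bar>u x\<bar> powr l)\<^sup>2"
    using assms by (simp add: powr_mult_eq_square[of \<alpha> \<gamma> \<delta>] powr_mult_eq_square[of q m l] power_mult_distrib)
  finally show "norm x powr \<delta> * \<bar>u x\<bar> powr l \<le>
     sqrt ((norm x powr \<alpha> * \<bar>u x\<bar> powr q) * (norm x powr \<gamma> * \<bar>u x\<bar> powr m))"
    by simp
qed (use assms in \<open>auto intro: integrable_weighted_powr\<close>)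

lemma sum_inner_products: "(\<Sum>b\<in>Basis. (x \<bullet> b) * (y \<bullet> b)) = x \<bullet> (y::'a)"
  by (simp add: euclidean_inner[of x y])

text \<open>The divergence of the field |x|^(\<alpha>-2) |u|^q x integrates to 0. Differentiating
  |x|^(\<alpha>-2) x gives n - 2 + \<alpha> times the integrand of the moment; the term with the
  gradient of u is controlled by Cauchy-Schwarz.\<close>

proposition hardy:
  assumes \<alpha>: "\<alpha> > 2 - n" and q: "q \<ge> 2"
  shows "moment (\<alpha> - 2) q \<le> (q / (n - 2 + \<alpha>))\<^sup>2 * energy \<alpha> q"
proof -
  define s where "s = n - 2 + \<alpha>"
  have s: "s > 0" using \<alpha> by (simp add: s_def)
  \<comment> \<open>The coordinates of x / |x|: they are bounded by 1 and their squares sum to 1 off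
    the origin. With them, \<open>D1\<close> and \<open>D2\<close> are weights times bounded
    factors.\<close>
  define e where "e b x = (x \<bullet> b) / norm x" for b x :: 'a
  have e_le: "\<bar>e b x\<bar> \<le> 1" if "b \<in> Basis" for b x
    using Basis_le_norm[OF that, of x] by (cases "x = 0") (auto simp: e_def)
  have [measurable]: "e b \<in> borel_measurable borel" for b unfolding e_def by measurable
  \<comment> \<open>The two parts of the b-th derivative of the b-th component of the field:
    \<open>D1\<close> from differentiating |x|^(\<alpha>-2) (x \<bullet> b), \<open>D2\<close> from
    differentiating |u|^q.\<close>
  define D1 where "D1 b x = norm x powr (\<alpha> - 2) * (\<bar>u x\<bar> powr q * ((\<alpha> - 2) * (e b x)\<^sup>2 + 1))" for b x
  define D2 where "D2 b x = norm x powr (\<alpha> - 1) * (\<bar>u x\<bar> powr (q - 1) * (q * sgn (u x) * e b x * (G x \<bullet> b)))" for b x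
  have D1_int: "integrable lborel (D1 b)" if b: "b \<in> Basis" for b
    unfolding D1_def
  proof (rule integrable_weighted[where K = "\<bar>\<alpha> - 2\<bar> + 1"])
    fix x
    have "\<bar>(\<alpha> - 2) * (e b x)\<^sup>2\<bar> \<le> \<bar>\<alpha> - 2\<bar> * 1"
      unfolding abs_mult using e_le[OF b, of x] by (intro mult_left_mono) (auto simp: abs_square_le_1)
    then show "\<bar>(\<alpha> - 2) * (e b x)\<^sup>2 + 1\<bar> \<le> \<bar>\<alpha> - 2\<bar> + 1"
      by (intro order_trans[OF abs_triangle_ineq]) simp
  qed (use \<alpha> q in auto)
  have D2_int: "integrable lborel (D2 b)" if b: "b \<in> Basis" for b
    unfolding D2_def
  proof (rule integrable_weighted[where K = "q * 1 * 1 * C"])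
    fix x
    have "\<bar>G x \<bullet> b\<bar> \<le> C" using Basis_le_norm[OF b, of "G x"] G_bound[of x] by linarith
    then show "\<bar>q * sgn (u x) * e b x * (G x \<bullet> b)\<bar> \<le> q * 1 * 1 * C"
      unfolding abs_mult using q e_le[OF b, of x] by (intro mult_mono) (auto simp: abs_sgn_eq)
  qed (use \<alpha> q in auto)
  have zero: "(\<integral>x. D1 b x + D2 b x \<partial>lborel) = 0" if b: "b \<in> Basis" for b
  proof (rule integral_directional_derivative_eq_0[where R = R and b = b
        and g = "\<lambda>x. norm x powr (\<alpha> - 2) * ((x \<bullet> b) * \<bar>u x\<bar> powr q)"])
    fix x :: 'a assume x: "x \<noteq> 0"
    have "((\<lambda>t. (x + t *\<^sub>R b) \<bullet> b) has_real_derivative 1) (at 0)"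
      unfolding inner_add_left inner_scaleR_left using b by (auto intro!: derivative_eq_intros simp: inner_Basis)
    note d = DERIV_mult[OF has_real_derivative_norm_powr_line[OF x, of b "\<alpha> - 2"]
        DERIV_mult[OF this has_real_derivative_abs_powr_compose[OF u_deriv[OF b], of q x]]]
    have eq: "norm x powr (\<alpha> - 4) = norm x powr (\<alpha> - 2) / (norm x)\<^sup>2"
      "norm x powr (\<alpha> - 1) = norm x powr (\<alpha> - 2) * norm x"
      using x powr_diff[of "norm x" "\<alpha> - 2" 2] powr_add[of "norm x" "\<alpha> - 2" 1] by (auto simp: algebra_simps)
    show "((\<lambda>t. norm (x + t *\<^sub>R b) powr (\<alpha> - 2) * (((x + t *\<^sub>R b) \<bullet> b) * \<bar>u (x + t *\<^sub>R b)\<bar> powr q))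
        has_real_derivative (D1 b x + D2 b x)) (at 0)"
      by (rule DERIV_cong[OF d])
        (use q x in \<open>auto simp: D1_def D2_def e_def eq power2_eq_square field_simps\<close>)
  qed (use b dim u_zero D1_int[OF b] D2_int[OF b] in auto)
  have sum_e: "(\<Sum>b\<in>Basis. (e b x)\<^sup>2) = 1" if "x \<noteq> 0" for x
    using that sum_inner_products[of x x]
    by (simp add: e_def power_divide sum_divide_distrib[symmetric] power2_norm_eq_inner power2_eq_square[of "_ \<bullet> _"])
  have sum_D1: "(\<Sum>b\<in>Basis. D1 b x) = s * (norm x powr (\<alpha> - 2) * \<bar>u x\<bar> powr q)" for x
  proof (cases "x = 0")
    case False
    have "(\<Sum>b\<in>Basis. D1 b x) = norm x powr (\<alpha> - 2) * (\<bar>u x\<bar> powr q * ((\<alpha> - 2) * (\<Sum>b\<in>Basis. (e b x)\<^sup>2) + n))"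
      by (simp add: D1_def sum_distrib_left[symmetric] sum.distrib n_def)
    then show ?thesis using sum_e[OF False] by (simp add: s_def algebra_simps)
  qed (simp add: D1_def)
  have sum_D2: "- (\<Sum>b\<in>Basis. D2 b x) \<le> q * (norm x powr (\<alpha> - 1) * (\<bar>u x\<bar> powr (q - 1) * norm (G x)))" for x
  proof -
    have "(\<Sum>b\<in>Basis. D2 b x) = norm x powr (\<alpha> - 1) * (\<bar>u x\<bar> powr (q - 1) * (q * sgn (u x) * (\<Sum>b\<in>Basis. e b x * (G x \<bullet> b))))"
      by (simp add: D2_def sum_distrib_left mult_ac)
    moreover have "(\<Sum>b\<in>Basis. e b x * (G x \<bullet> b)) = (x \<bullet> G x) / norm x"
      using sum_inner_products[of x "G x"] by (simp add: e_def sum_divide_distrib[symmetric])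
    moreover have "- (q * sgn (u x) * ((x \<bullet> G x) / norm x)) \<le> q * norm (G x)"
    proof -
      have "\<bar>(x \<bullet> G x) / norm x\<bar> \<le> norm (G x)"
        using Cauchy_Schwarz_ineq2[of x "G x"] by (cases "x = 0") (auto simp: field_simps)
      then have "\<bar>sgn (u x) * ((x \<bullet> G x) / norm x)\<bar> \<le> norm (G x)"
        unfolding abs_mult by (auto simp: abs_sgn_eq)
      then have "- (sgn (u x) * ((x \<bullet> G x) / norm x)) \<le> norm (G x)" by linarith
      then have "q * - (sgn (u x) * ((x \<bullet> G x) / norm x)) \<le> q * norm (G x)"
        using q by (intro mult_left_mono) auto
      then show ?thesis by (simp add: mult.assoc)
    qed
    then have "norm x powr (\<alpha> - 1) * (\<bar>u x\<bar> powr (q - 1) * - (q * sgn (u x) * ((x \<bullet> G x) / norm x)))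
       \<le> norm x powr (\<alpha> - 1) * (\<bar>u x\<bar> powr (q - 1) * (q * norm (G x)))"
      by (intro mult_left_mono) auto
    ultimately show ?thesis by (simp add: mult_ac)
  qed
  have "0 = (\<Sum>b\<in>Basis. (\<integral>x. D1 b x + D2 b x \<partial>lborel))"
    using zero by simp
  also have "\<dots> = (\<integral>x. (\<Sum>b\<in>Basis. D1 b x) \<partial>lborel) + (\<integral>x. (\<Sum>b\<in>Basis. D2 b x) \<partial>lborel)"
    using D1_int D2_int by (simp add: sum.distrib)
  also have "(\<integral>x. (\<Sum>b\<in>Basis. D1 b x) \<partial>lborel) = s * moment (\<alpha> - 2) q"
    by (simp add: sum_D1 moment_def)
  finally have "s * moment (\<alpha> - 2) q = (\<integral>x. - (\<Sum>b\<in>Basis. D2 b x) \<partial>lborel)"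
    by (simp del: Bochner_Integration.integral_sum)
  also have "\<dots> \<le> (\<integral>x. q * (norm x powr (\<alpha> - 1) * (\<bar>u x\<bar> powr (q - 1) * norm (G x))) \<partial>lborel)"
    using D2_int \<alpha> q by (intro integral_mono sum_D2 integrable_mult_right integrable_weighted_gradient
        Bochner_Integration.integrable_minus Bochner_Integration.integrable_sum) auto
  also have "\<dots> = q * (\<integral>x. norm x powr (\<alpha> - 1) * (\<bar>u x\<bar> powr (q - 1) * norm (G x)) \<partial>lborel)"
    by simp
  also have "\<dots> \<le> q * sqrt (energy \<alpha> q * moment (\<alpha> - 2) q)"
    using \<alpha> q by (intro mult_left_mono gradient_Cauchy_Schwarz) auto
  finally have le: "s * moment (\<alpha> - 2) q \<le> q * sqrt (energy \<alpha> q * moment (\<alpha> - 2) q)" .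
  \<comment> \<open>After squaring, one factor of the moment cancels, provided that it is positive;
    otherwise the claim is trivial.\<close>
  show ?thesis
  proof (cases "moment (\<alpha> - 2) q = 0")
    case False
    then have H: "moment (\<alpha> - 2) q > 0" using moment_nonneg[of "\<alpha> - 2" q] by linarith
    have "(s * moment (\<alpha> - 2) q)\<^sup>2 \<le> (q * sqrt (energy \<alpha> q * moment (\<alpha> - 2) q))\<^sup>2"
      using le s H by (intro power_mono) auto
    also have "\<dots> = q\<^sup>2 * energy \<alpha> q * moment (\<alpha> - 2) q"
      using energy_nonneg moment_nonneg by (simp add: power_mult_distrib)
    finally have "s\<^sup>2 * moment (\<alpha> - 2) q \<le> q\<^sup>2 * energy \<alpha> q"
      using H by (simp add: power2_eq_square)
    then show ?thesis using s unfolding s_def[symmetric] by (simp add: power_divide field_simps)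
  qed (use energy_nonneg in simp)
qed

text \<open>\<open>gagliardo_nirenberg\<close> bounds the moment X by a power of the integral of
  \<open>h\<close>. Cauchy-Schwarz bounds that integral by a multiple of sqrt (E X), with Hardy's
  inequality for the term in which the weight is differentiated. Finally a factor X is absorbed on
  the left.\<close>

proposition sobolev:
  assumes \<alpha>: "\<alpha> > 2 - n" and q: "q \<ge> 2"
  defines "c \<equiv> \<bar>\<alpha> * (n - 1) / (n - 2)\<bar> * (q / (n - 2 + \<alpha>)) + q * (n - 1) / (n - 2)"
  shows "moment (\<alpha> * n / (n - 2)) (q * n / (n - 2)) \<le> (c\<^sup>2 * energy \<alpha> q) powr (n / (n - 2))"
proof -
  note n = n_gt
  define a where "a = \<alpha> * (n - 1) / (n - 2)"
  define k where "k = q * (n - 1) / (n - 2)"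
  define \<gamma> where "\<gamma> = \<alpha> * n / (n - 2)"
  define m where "m = q * n / (n - 2)"
  have \<gamma>: "\<gamma> > - n"
  proof -
    have "(2 - n) * n < \<alpha> * n" using \<alpha> n by (intro mult_strict_right_mono) auto
    then show ?thesis using n by (simp add: \<gamma>_def field_simps)
  qed
  have a: "a - 1 > - n"
  proof -
    have "(2 - n) * (n - 1) < \<alpha> * (n - 1)" using \<alpha> n by (intro mult_strict_right_mono) auto
    then show ?thesis using n by (simp add: a_def field_simps)
  qed
  have k: "k > 1"
  proof -
    have "1 * (n - 2) < q * (n - 1)" using q n by (intro mult_le_less_imp_less) auto
    then show ?thesis using n by (simp add: k_def field_simps)
  qed
  have m0: "m \<ge> 0" using q n by (simp add: m_def)
  \<comment> \<open>These identities place the exponents of both summands of \<open>h\<close>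
    halfway between those of X and those of the Hardy moment or the energy; \<open>ak'\<close> says
    that |g|^(n/(n-1)) is the integrand of X.\<close>
  have ak: "\<alpha> - 2 + \<gamma> = 2 * (a - 1)" "\<alpha> + \<gamma> = 2 * a" "q + m = 2 * k" "q - 2 + m = 2 * (k - 1)"
    using n by (auto simp: \<gamma>_def a_def k_def m_def field_simps)
  have ak': "a * (n / (n - 1)) = \<gamma>" "k * (n / (n - 1)) = m"
    using n by (simp_all add: \<gamma>_def a_def k_def m_def)
  define X where "X = moment \<gamma> m"
  define E where "E = energy \<alpha> q"
  \<comment> \<open>A common majorant of the directional derivatives of \<open>g\<close>: the first
    summand comes from |x|^a, the second from |u|^k.\<close>
  define h where "h x = \<bar>a\<bar> * (norm x powr (a - 1) * \<bar>u x\<bar> powr k)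
      + k * (norm x powr a * (\<bar>u x\<bar> powr (k - 1) * norm (G x)))" for x
  have h1: "integrable lborel (\<lambda>x. norm x powr (a - 1) * \<bar>u x\<bar> powr k)"
    using a k by (intro integrable_weighted_powr) auto
  have h2: "integrable lborel (\<lambda>x. norm x powr a * (\<bar>u x\<bar> powr (k - 1) * norm (G x)))"
    using a k by (intro integrable_weighted_gradient) auto
  have h_int: "integrable lborel h"
    unfolding h_def using h1 h2 by (intro Bochner_Integration.integrable_add integrable_mult_right)
  have h0: "h x \<ge> 0" for x using k by (simp add: h_def)
  define g where "g x = norm x powr a * \<bar>u x\<bar> powr k" for x
  define g' where "g' b x = norm x powr a * (k * \<bar>u x\<bar> powr (k - 1) * sgn (u x) * (G x \<bullet> b))
       + a * norm x powr (a - 2) * (x \<bullet> b) * \<bar>u x\<bar> powr k" for b x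
  have g_powr: "\<bar>g x\<bar> powr (n / (n - 1)) = norm x powr \<gamma> * \<bar>u x\<bar> powr m" for x
    using ak' by (simp add: g_def abs_mult powr_mult powr_powr)
  have "(\<integral>\<^sup>+x. ennreal (\<bar>g x\<bar> powr (n / (n - 1))) \<partial>lborel) \<le> ennreal ((\<integral>x. h x \<partial>lborel) powr (n / (n - 1)))"
    unfolding n_def
  proof (rule gagliardo_nirenberg[where R = R and g' = g'])
    show "g \<in> borel_measurable borel" unfolding g_def by measurable
    fix b x :: 'a assume b: "b \<in> Basis" and x: "x \<noteq> 0"
    note d = DERIV_mult[OF has_real_derivative_norm_powr_line[OF x, of b a]
        has_real_derivative_abs_powr_compose[OF u_deriv[OF b] k, of x]]
    show "((\<lambda>t. g (x + t *\<^sub>R b)) has_real_derivative g' b x) (at 0)"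
      unfolding g_def by (rule DERIV_cong[OF d]) (simp add: g'_def)
    have "\<bar>g' b x\<bar> \<le> \<bar>norm x powr a * (k * \<bar>u x\<bar> powr (k - 1) * sgn (u x) * (G x \<bullet> b))\<bar>
       + \<bar>a * norm x powr (a - 2) * (x \<bullet> b) * \<bar>u x\<bar> powr k\<bar>"
      unfolding g'_def by (rule abs_triangle_ineq)
    also have "\<bar>norm x powr a * (k * \<bar>u x\<bar> powr (k - 1) * sgn (u x) * (G x \<bullet> b))\<bar>
       \<le> norm x powr a * (k * \<bar>u x\<bar> powr (k - 1) * 1 * norm (G x))"
      unfolding abs_mult using Basis_le_norm[OF b, of "G x"] k by (intro mult_mono) (auto simp: abs_sgn_eq)
    also have "\<bar>a * norm x powr (a - 2) * (x \<bullet> b) * \<bar>u x\<bar> powr k\<bar>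
       \<le> \<bar>a\<bar> * norm x powr (a - 2) * norm x * \<bar>u x\<bar> powr k"
      unfolding abs_mult using Basis_le_norm[OF b, of x] by (intro mult_mono) auto
    also have "\<bar>a\<bar> * norm x powr (a - 2) * norm x * \<bar>u x\<bar> powr k = \<bar>a\<bar> * (norm x powr (a - 1) * \<bar>u x\<bar> powr k)"
      using powr_add[of "norm x" "a - 2" 1] by (simp add: mult_ac)
    finally show "\<bar>g' b x\<bar> \<le> h x" by (simp add: h_def mult_ac)
  qed (use dim u_zero h_int h0 in \<open>auto simp: g_def\<close>)
  also have "(\<integral>\<^sup>+x. ennreal (\<bar>g x\<bar> powr (n / (n - 1))) \<partial>lborel) = ennreal X"
    unfolding g_powr X_def moment_def using \<gamma> m0 by (intro nn_integral_eq_integral integrable_weighted_powr) auto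
  finally have X_le: "X \<le> (\<integral>x. h x \<partial>lborel) powr (n / (n - 1))" by simp
  have E0: "E \<ge> 0" and X0: "X \<ge> 0" by (simp_all add: E_def X_def energy_nonneg moment_nonneg)
  have "(\<integral>x. h x \<partial>lborel) = \<bar>a\<bar> * moment (a - 1) k
      + k * (\<integral>x. norm x powr a * (\<bar>u x\<bar> powr (k - 1) * norm (G x)) \<partial>lborel)"
    unfolding h_def moment_def using h1 h2 by simp
  also have "\<dots> \<le> \<bar>a\<bar> * sqrt (moment (\<alpha> - 2) q * X) + k * sqrt (E * X)"
    unfolding X_def E_def using \<alpha> q \<gamma> m0 a k ak
    by (intro add_mono mult_left_mono moment_Cauchy_Schwarz gradient_Cauchy_Schwarz) auto
  finally have "(\<integral>x. h x \<partial>lborel) \<le> \<bar>a\<bar> * sqrt (moment (\<alpha> - 2) q * X) + k * sqrt (E * X)" .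
  moreover have "\<bar>a\<bar> * sqrt (moment (\<alpha> - 2) q * X) \<le> \<bar>a\<bar> * (q / (n - 2 + \<alpha>) * sqrt (E * X))"
  proof (rule mult_left_mono)
    have "sqrt (moment (\<alpha> - 2) q * X) \<le> sqrt ((q / (n - 2 + \<alpha>))\<^sup>2 * E * X)"
      unfolding E_def using hardy[OF \<alpha> q] X0 by (intro real_sqrt_le_mono mult_right_mono) auto
    also have "\<dots> = q / (n - 2 + \<alpha>) * sqrt (E * X)"
      using \<alpha> q by (simp add: real_sqrt_mult mult.assoc)
    finally show "sqrt (moment (\<alpha> - 2) q * X) \<le> q / (n - 2 + \<alpha>) * sqrt (E * X)" .
  qed simp
  moreover have "c * sqrt (E * X) = \<bar>a\<bar> * (q / (n - 2 + \<alpha>) * sqrt (E * X)) + k * sqrt (E * X)"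
    unfolding c_def a_def k_def by (simp only: distrib_right mult.assoc)
  ultimately have "(\<integral>x. h x \<partial>lborel) \<le> c * sqrt (E * X)" by linarith
  moreover have "(\<integral>x. h x \<partial>lborel) \<ge> 0" using h0 by simp
  ultimately have X_le': "X \<le> (c * sqrt (E * X)) powr (n / (n - 1))"
    using X_le n by (smt (verit) powr_mono2 divide_nonneg_nonneg)
  show ?thesis
  proof (cases "X = 0")
    case False
    then have X: "X > 0" using X0 by simp
    have c: "c \<ge> 0" using \<alpha> q n by (simp add: c_def)
    \<comment> \<open>This power turns the right-hand side into a square, and 2(n-1)/n = 1 +
      (n-2)/n, so one factor X cancels.\<close>
    have "X powr (2 * (n - 1) / n) \<le> ((c * sqrt (E * X)) powr (n / (n - 1))) powr (2 * (n - 1) / n)"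
      using X_le' X n by (intro powr_mono2) auto
    also have "\<dots> = (c * sqrt (E * X)) powr 2"
    proof -
      have "n / (n - 1) * (2 * (n - 1) / n) = 2" using n by (simp add: field_simps)
      then show ?thesis by (simp only: powr_powr)
    qed
    also have "\<dots> = c\<^sup>2 * E * X"
      using c E0 X0 by (simp add: power_mult_distrib)
    finally have "X powr (1 + (n - 2) / n) \<le> c\<^sup>2 * E * X"
      using n by (simp add: field_simps)
    then have "X powr ((n - 2) / n) \<le> c\<^sup>2 * E"
      using X by (simp add: powr_add)
    then have "(X powr ((n - 2) / n)) powr (n / (n - 2)) \<le> (c\<^sup>2 * E) powr (n / (n - 2))"
      using n by (intro powr_mono2) auto
    then show ?thesis using n X by (simp add: powr_powr X_def E_def \<gamma>_def m_def)
  qed (simp add: X_def \<gamma>_def m_def)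
qed

end

section \<open>The second-order inequality\<close>

text \<open>\<open>H b\<close> is the pure second derivative in direction \<open>b\<close>: the
  divergence of |x|^\<alpha> G involves the Hessian only through its trace.\<close>

locale bounded_support_hessian = bounded_support_gradient +
  fixes H :: "'a \<Rightarrow> 'a \<Rightarrow> real"
  assumes G_deriv: "\<And>b x. b \<in> Basis \<Longrightarrow> ((\<lambda>t. G (x + t *\<^sub>R b) \<bullet> b) has_real_derivative H b x) (at 0)"
    and H_meas [measurable]: "\<And>b. b \<in> Basis \<Longrightarrow> H b \<in> borel_measurable borel"
    and H_bound: "\<And>b x. b \<in> Basis \<Longrightarrow> \<bar>H b x\<bar> \<le> C"
    and G_zero: "\<And>x. norm x > R \<Longrightarrow> G x = 0"
    and R_nonneg: "R \<ge> 0" and H_zero: "\<And>b x. b \<in> Basis \<Longrightarrow> norm x > R \<Longrightarrow> H b x = 0"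
begin

text \<open>The divergence of |x|^\<alpha> G, expanded by the product rule. At the origin it is 0,
  as both powers of the norm are.\<close>

definition weighted_laplacian :: "real \<Rightarrow> 'a \<Rightarrow> real" where
  "weighted_laplacian \<alpha> x =
    norm x powr \<alpha> * (\<Sum>b\<in>Basis. H b x) + \<alpha> * norm x powr (\<alpha> - 2) * (x \<bullet> G x)"

lemma weighted_laplacian_meas [measurable]: "weighted_laplacian \<alpha> \<in> borel_measurable borel"
  unfolding weighted_laplacian_def[abs_def] by measurable

lemma C_nonneg: "C \<ge> 0"
  using u_bound[of 0] by linarith

text \<open>On the support |x| \<le> R, hence |x|^\<alpha> \<le> R |x|^(\<alpha>-1), and both terms
  have the same order at the origin.\<close>

lemma weighted_laplacian_le:
  "\<bar>weighted_laplacian \<alpha> x\<bar> \<le> (R * n * C + \<bar>\<alpha>\<bar> * C) * norm x powr (\<alpha> - 1)"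
proof -
  consider "norm x > R" | "norm x \<le> R" by linarith
  then show ?thesis
  proof cases
    case 1
    then have "weighted_laplacian \<alpha> x = 0" by (simp add: weighted_laplacian_def G_zero H_zero)
    then show ?thesis using C_nonneg n_gt R_nonneg by simp
  next
    case 2
    have p: "norm x powr \<alpha> = norm x * norm x powr (\<alpha> - 1)" "norm x powr (\<alpha> - 1) = norm x powr (\<alpha> - 2) * norm x"
      using powr_add[of "norm x" "\<alpha> - 1" 1] powr_add[of "norm x" "\<alpha> - 2" 1] by (auto simp: mult.commute)
    have "\<bar>\<Sum>b\<in>(Basis::'a set). H b x\<bar> \<le> (\<Sum>b\<in>(Basis::'a set). C)"
      by (intro order_trans[OF sum_abs] sum_mono H_bound)
    then have "\<bar>norm x powr \<alpha> * (\<Sum>b\<in>Basis. H b x)\<bar> \<le> (R * norm x powr (\<alpha> - 1)) * (n * C)"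
      unfolding abs_mult p(1) using 2 R_nonneg by (intro mult_mono) (auto simp: n_def intro: mult_right_mono)
    moreover have "\<bar>\<alpha> * norm x powr (\<alpha> - 2) * (x \<bullet> G x)\<bar> \<le> \<bar>\<alpha>\<bar> * norm x powr (\<alpha> - 2) * (norm x * C)"
      unfolding abs_mult using order_trans[OF Cauchy_Schwarz_ineq2[of x "G x"] mult_left_mono[OF G_bound norm_ge_zero]]
      by (intro mult_mono) auto
    ultimately have "\<bar>weighted_laplacian \<alpha> x\<bar>
        \<le> (R * norm x powr (\<alpha> - 1)) * (n * C) + \<bar>\<alpha>\<bar> * norm x powr (\<alpha> - 2) * (norm x * C)"
      unfolding weighted_laplacian_def by (intro order_trans[OF abs_triangle_ineq] add_mono)
    also have "\<dots> = (R * n * C + \<bar>\<alpha>\<bar> * C) * norm x powr (\<alpha> - 1)"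
      unfolding p(2) by (simp add: algebra_simps)
    finally show ?thesis .
  qed
qed

text \<open>The divergence of |x|^\<alpha> \<phi>(u) G integrates to 0, where \<phi>(u) = |u|^(q-2)
  u. This gives the tested equation, to which Cauchy-Schwarz is applied. The assumption
  \<open>\<beta>'\<close> makes the weighted square of the divergence integrable.\<close>

proposition energy_le:
  assumes \<alpha>: "\<alpha> > 2 - n" and q: "q \<ge> 2"
    and \<beta>: "\<beta> > - n" and \<beta>': "2 * \<alpha> - 2 - \<beta> > - n"
  shows "(q - 1) * energy \<alpha> q \<le> sqrt ((\<integral>x. norm x powr (- \<beta>) * (weighted_laplacian \<alpha> x)\<^sup>2 \<partial>lborel)
      * moment \<beta> (2 * q - 2))"
proof -
  define \<phi> where "\<phi> y = sgn y * \<bar>y\<bar> powr (q - 1)" for y :: real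
  \<comment> \<open>The case distinction repairs \<open>0 powr 0 = 0\<close>: for \<open>q = 2\<close>, \<open>\<phi>\<close> is the identity.\<close>
  define \<phi>' where "\<phi>' y = (if q - 1 = 1 then 1 else (q - 1) * \<bar>y\<bar> powr (q - 1 - 1))" for y :: real
  have [measurable]: "\<phi> \<in> borel_measurable borel" "\<phi>' \<in> borel_measurable borel"
    unfolding \<phi>_def \<phi>'_def by measurable
  have \<phi>_abs: "\<bar>\<phi> y\<bar> = \<bar>y\<bar> powr (q - 1)" for y
    by (simp add: \<phi>_def abs_mult abs_sgn_eq)
  define K where "K = C powr (q - 1)"
  have K0: "K \<ge> 0" by (simp add: K_def)
  have \<phi>_le: "\<bar>\<phi> (u x)\<bar> \<le> K" for x
    unfolding \<phi>_abs K_def using u_bound q by (intro powr_mono2) auto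
  define K' where "K' = 1 + (q - 1) * C powr (q - 1 - 1)"
  have \<phi>'_le: "\<bar>\<phi>' (u x)\<bar> \<le> K'" for x
  proof -
    have "\<bar>u x\<bar> powr (q - 1 - 1) \<le> C powr (q - 1 - 1)" using u_bound q by (intro powr_mono2) auto
    then have "(q - 1) * \<bar>u x\<bar> powr (q - 1 - 1) \<le> (q - 1) * C powr (q - 1 - 1)"
      using q by (intro mult_left_mono) auto
    moreover have "\<bar>\<phi>' (u x)\<bar> = 1 \<or> \<bar>\<phi>' (u x)\<bar> = (q - 1) * \<bar>u x\<bar> powr (q - 1 - 1)"
      using q by (auto simp: \<phi>'_def abs_mult)
    moreover have "(q - 1) * C powr (q - 1 - 1) \<ge> 0" using q by simp
    ultimately show ?thesis unfolding K'_def by linarith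
  qed
  \<comment> \<open>Equality holds except for q = 2 and y = 0, where the left-hand side is 0. The
    inequality has the direction required for bounding the energy from above.\<close>
  have \<phi>'_ge: "(q - 1) * \<bar>y\<bar> powr (q - 2) \<le> \<phi>' y" for y
    by (auto simp: \<phi>'_def)
  have Gb_le: "\<bar>G x \<bullet> b\<bar> \<le> C" if "b \<in> Basis" for b x
    using Basis_le_norm[OF that, of "G x"] G_bound[of x] by linarith
  \<comment> \<open>The derivative falls on the weight in \<open>T1\<close>, on \<phi>(u) in
    \<open>T2\<close> and on the gradient in \<open>T3\<close>. Summed over the basis,
    \<open>T1\<close> and \<open>T3\<close> give \<phi>(u) times the weighted Laplacian, and
    \<open>T2\<close> dominates the energy density times q - 1.\<close>
  define T1 where "T1 b x = \<alpha> * norm x powr (\<alpha> - 2) * (x \<bullet> b) * (\<phi> (u x) * (G x \<bullet> b))" for b x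
  define T2 where "T2 b x = norm x powr \<alpha> * (\<phi>' (u x) * (G x \<bullet> b)\<^sup>2)" for b x
  define T3 where "T3 b x = norm x powr \<alpha> * (\<phi> (u x) * H b x)" for b x
  have [measurable]: "T1 b \<in> borel_measurable borel" "T2 b \<in> borel_measurable borel" for b
    unfolding T1_def T2_def by measurable
  have [measurable]: "T3 b \<in> borel_measurable borel" if [measurable]: "b \<in> Basis" for b
    unfolding T3_def by measurable
  have T1_int: "integrable lborel (T1 b)" if b: "b \<in> Basis" for b
  proof (rule integrable_bound_norm_powr[where R = R and \<gamma> = "\<alpha> - 1" and C = "\<bar>\<alpha>\<bar> * (K * C)"])
    fix x
    have "\<bar>T1 b x\<bar> \<le> \<bar>\<alpha>\<bar> * norm x powr (\<alpha> - 2) * norm x * (K * C)"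
      unfolding T1_def abs_mult using \<phi>_le[of x] Gb_le[OF b, of x] Basis_le_norm[OF b, of x] K0
      by (intro mult_mono) auto
    also have "\<dots> = \<bar>\<alpha>\<bar> * (K * C) * norm x powr (\<alpha> - 1)"
      using powr_add[of "norm x" "\<alpha> - 2" 1] by (simp add: mult_ac)
    finally show "\<bar>T1 b x\<bar> \<le> \<bar>\<alpha>\<bar> * (K * C) * norm x powr (\<alpha> - 1)" .
  qed (use \<alpha> G_zero in \<open>auto simp: T1_def n_def\<close>)
  have T2_int: "integrable lborel (T2 b)" if b: "b \<in> Basis" for b
  proof (rule integrable_bound_norm_powr[where R = R and \<gamma> = \<alpha> and C = "K' * C\<^sup>2"])
    fix x
    have "(G x \<bullet> b)\<^sup>2 \<le> C\<^sup>2" using Gb_le[OF b, of x] by (metis abs_ge_zero power2_abs power_mono)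
    then have "\<bar>T2 b x\<bar> \<le> norm x powr \<alpha> * (K' * C\<^sup>2)"
      unfolding T2_def abs_mult using \<phi>'_le[of x] by (intro mult_mono) auto
    then show "\<bar>T2 b x\<bar> \<le> K' * C\<^sup>2 * norm x powr \<alpha>" by (simp add: mult_ac)
  qed (use \<alpha> G_zero in \<open>auto simp: T2_def n_def\<close>)
  have T3_int: "integrable lborel (T3 b)" if b: "b \<in> Basis" for b
  proof (rule integrable_bound_norm_powr[where R = R and \<gamma> = \<alpha> and C = "K * C"])
    fix x
    have "\<bar>T3 b x\<bar> \<le> norm x powr \<alpha> * (K * C)"
      unfolding T3_def abs_mult using \<phi>_le[of x] H_bound[OF b, of x] K0 by (intro mult_mono) auto
    then show "\<bar>T3 b x\<bar> \<le> K * C * norm x powr \<alpha>" by (simp add: mult_ac)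
  qed (use \<alpha> b H_zero in \<open>auto simp: T3_def n_def\<close>)
  have zero: "(\<integral>x. T1 b x + T3 b x + T2 b x \<partial>lborel) = 0" if b: "b \<in> Basis" for b
  proof (rule integral_directional_derivative_eq_0[where R = R and b = b
        and g = "\<lambda>x. norm x powr \<alpha> * (\<phi> (u x) * (G x \<bullet> b))"])
    fix x :: 'a assume x: "x \<noteq> 0"
    have "(\<phi> has_real_derivative \<phi>' (u x)) (at (u (x + 0 *\<^sub>R b)))"
      unfolding \<phi>_def[abs_def] \<phi>'_def using has_real_derivative_sgn_abs_powr[of "q - 1" "u x"] q by simp
    note d = DERIV_mult[OF has_real_derivative_norm_powr_line[OF x, of b \<alpha>]
        DERIV_mult[OF DERIV_chain2[OF this u_deriv[OF b]] G_deriv[OF b]]]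
    show "((\<lambda>t. norm (x + t *\<^sub>R b) powr \<alpha> * (\<phi> (u (x + t *\<^sub>R b)) * (G (x + t *\<^sub>R b) \<bullet> b)))
        has_real_derivative (T1 b x + T3 b x + T2 b x)) (at 0)"
      by (rule DERIV_cong[OF d]) (simp add: T1_def T2_def T3_def power2_eq_square algebra_simps)
  qed (use b dim u_zero T1_int[OF b] T2_int[OF b] T3_int[OF b] in \<open>auto simp: \<phi>_def\<close>)
  have sum13: "(\<Sum>b\<in>Basis. T1 b x + T3 b x) = \<phi> (u x) * weighted_laplacian \<alpha> x" for x
  proof -
    have "(\<Sum>b\<in>Basis. T1 b x) = \<alpha> * norm x powr (\<alpha> - 2) * \<phi> (u x) * (\<Sum>b\<in>Basis. (x \<bullet> b) * (G x \<bullet> b))"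
      by (simp add: T1_def sum_distrib_left mult_ac)
    moreover have "(\<Sum>b\<in>Basis. T3 b x) = norm x powr \<alpha> * \<phi> (u x) * (\<Sum>b\<in>Basis. H b x)"
      by (simp add: T3_def sum_distrib_left mult_ac)
    ultimately show ?thesis
      by (simp add: sum.distrib sum_inner_products weighted_laplacian_def algebra_simps)
  qed
  have sum2: "(\<Sum>b\<in>Basis. T2 b x) = norm x powr \<alpha> * (\<phi>' (u x) * (norm (G x))\<^sup>2)" for x
    using sum_inner_products[of "G x" "G x"]
    by (simp add: T2_def sum_distrib_left[symmetric] power2_eq_square[of "_ \<bullet> _"] power2_norm_eq_inner)
  have int13: "integrable lborel (\<lambda>x. \<phi> (u x) * weighted_laplacian \<alpha> x)"
    unfolding sum13[symmetric] using T1_int T3_int by (intro Bochner_Integration.integrable_sum) auto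
  have int2: "integrable lborel (\<lambda>x. norm x powr \<alpha> * (\<phi>' (u x) * (norm (G x))\<^sup>2))"
    unfolding sum2[symmetric] using T2_int by (intro Bochner_Integration.integrable_sum) auto
  have "0 = (\<Sum>b\<in>Basis. (\<integral>x. T1 b x + T3 b x + T2 b x \<partial>lborel))"
    using zero by simp
  also have "\<dots> = (\<integral>x. (\<Sum>b\<in>Basis. T1 b x + T3 b x + T2 b x) \<partial>lborel)"
    using T1_int T2_int T3_int by (intro Bochner_Integration.integral_sum[symmetric]) auto
  also have "\<dots> = (\<integral>x. \<phi> (u x) * weighted_laplacian \<alpha> x + norm x powr \<alpha> * (\<phi>' (u x) * (norm (G x))\<^sup>2) \<partial>lborel)"
    by (subst sum.distrib) (simp only: sum13 sum2)
  also have "\<dots> = (\<integral>x. \<phi> (u x) * weighted_laplacian \<alpha> x \<partial>lborel)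
      + (\<integral>x. norm x powr \<alpha> * (\<phi>' (u x) * (norm (G x))\<^sup>2) \<partial>lborel)"
    using int13 int2 by (rule Bochner_Integration.integral_add)
  finally have ibp: "(\<integral>x. norm x powr \<alpha> * (\<phi>' (u x) * (norm (G x))\<^sup>2) \<partial>lborel)
      = (\<integral>x. - (\<phi> (u x) * weighted_laplacian \<alpha> x) \<partial>lborel)" by simp
  have "(q - 1) * energy \<alpha> q
      = (\<integral>x. (q - 1) * (norm x powr \<alpha> * (\<bar>u x\<bar> powr (q - 2) * (norm (G x))\<^sup>2)) \<partial>lborel)"
    by (simp add: energy_def)
  also have "\<dots> \<le> (\<integral>x. norm x powr \<alpha> * (\<phi>' (u x) * (norm (G x))\<^sup>2) \<partial>lborel)"
  proof (intro integral_mono integrable_mult_right integrable_energy int2)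
    fix x
    have "norm x powr \<alpha> * (((q - 1) * \<bar>u x\<bar> powr (q - 2)) * (norm (G x))\<^sup>2)
        \<le> norm x powr \<alpha> * (\<phi>' (u x) * (norm (G x))\<^sup>2)"
      by (intro mult_left_mono mult_right_mono \<phi>'_ge) auto
    then show "(q - 1) * (norm x powr \<alpha> * (\<bar>u x\<bar> powr (q - 2) * (norm (G x))\<^sup>2))
        \<le> norm x powr \<alpha> * (\<phi>' (u x) * (norm (G x))\<^sup>2)" by (simp add: mult_ac)
  qed (use \<alpha> q in auto)
  also note ibp
  also have "(\<integral>x. - (\<phi> (u x) * weighted_laplacian \<alpha> x) \<partial>lborel)
      \<le> sqrt ((\<integral>x. norm x powr (- \<beta>) * (weighted_laplacian \<alpha> x)\<^sup>2 \<partial>lborel) * moment \<beta> (2 * q - 2))"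
    unfolding moment_def
  proof (rule integral_Cauchy_Schwarz)
    show "integrable lborel (\<lambda>x. norm x powr (- \<beta>) * (weighted_laplacian \<alpha> x)\<^sup>2)"
    proof (rule integrable_bound_norm_powr[where R = R and \<gamma> = "2 * \<alpha> - 2 - \<beta>" and C = "(R * n * C + \<bar>\<alpha>\<bar> * C)\<^sup>2"])
      fix x
      have "(weighted_laplacian \<alpha> x)\<^sup>2 \<le> ((R * n * C + \<bar>\<alpha>\<bar> * C) * norm x powr (\<alpha> - 1))\<^sup>2"
        using power_mono[OF weighted_laplacian_le[of \<alpha> x], of 2] by simp
      also have "\<dots> = (R * n * C + \<bar>\<alpha>\<bar> * C)\<^sup>2 * norm x powr (2 * \<alpha> - 2)"
        using powr_add[of "norm x" "\<alpha> - 1" "\<alpha> - 1"] by (simp add: power_mult_distrib power2_eq_square)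
      finally have "norm x powr (- \<beta>) * (weighted_laplacian \<alpha> x)\<^sup>2
          \<le> norm x powr (- \<beta>) * ((R * n * C + \<bar>\<alpha>\<bar> * C)\<^sup>2 * norm x powr (2 * \<alpha> - 2))"
        by (intro mult_left_mono) auto
      also have "\<dots> = (R * n * C + \<bar>\<alpha>\<bar> * C)\<^sup>2 * norm x powr (2 * \<alpha> - 2 - \<beta>)"
        using powr_add[of "norm x" "2 * \<alpha> - 2" "- \<beta>"] by simp
      finally show "\<bar>norm x powr (- \<beta>) * (weighted_laplacian \<alpha> x)\<^sup>2\<bar>
          \<le> (R * n * C + \<bar>\<alpha>\<bar> * C)\<^sup>2 * norm x powr (2 * \<alpha> - 2 - \<beta>)"
        by (simp add: abs_mult)
    qed (use \<beta>' G_zero H_zero in \<open>auto simp: n_def weighted_laplacian_def\<close>)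
    show "integrable lborel (\<lambda>x. norm x powr \<beta> * \<bar>u x\<bar> powr (2 * q - 2))"
      using \<beta> q by (intro integrable_weighted_powr) auto
    show "integrable lborel (\<lambda>x. - (\<phi> (u x) * weighted_laplacian \<alpha> x))" using int13 by simp
    fix x
    \<comment> \<open>Off the origin the weights |x|^(-\<beta>) and |x|^\<beta> cancel, and
      |u|^(2q-2) is the square of \<phi>(u). At the origin both sides are 0.\<close>
    show "- (\<phi> (u x) * weighted_laplacian \<alpha> x)
        \<le> sqrt (norm x powr (- \<beta>) * (weighted_laplacian \<alpha> x)\<^sup>2 * (norm x powr \<beta> * \<bar>u x\<bar> powr (2 * q - 2)))"
    proof (cases "x = 0")
      case True
      then show ?thesis by (simp add: weighted_laplacian_def)
    next
      case False
      have one: "norm x powr (- \<beta>) * norm x powr \<beta> = 1"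
        using False by (simp add: powr_add[symmetric])
      have sq: "\<bar>u x\<bar> powr (2 * q - 2) = (\<phi> (u x))\<^sup>2"
      proof -
        have "(\<phi> (u x))\<^sup>2 = \<bar>\<phi> (u x)\<bar> * \<bar>\<phi> (u x)\<bar>" by (simp add: power2_eq_square)
        then show ?thesis
          unfolding \<phi>_abs using powr_add[of "\<bar>u x\<bar>" "q - 1" "q - 1"] by simp
      qed
      have "norm x powr (- \<beta>) * (weighted_laplacian \<alpha> x)\<^sup>2 * (norm x powr \<beta> * \<bar>u x\<bar> powr (2 * q - 2))
          = (norm x powr (- \<beta>) * norm x powr \<beta>) * ((weighted_laplacian \<alpha> x)\<^sup>2 * (\<phi> (u x))\<^sup>2)"
        unfolding sq by (simp only: mult_ac)
      then have eq: "norm x powr (- \<beta>) * (weighted_laplacian \<alpha> x)\<^sup>2 * (norm x powr \<beta> * \<bar>u x\<bar> powr (2 * q - 2))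
          = (\<phi> (u x) * weighted_laplacian \<alpha> x)\<^sup>2"
        by (simp only: one) (simp add: power_mult_distrib)
      show ?thesis unfolding eq by simp
    qed
  qed auto
  finally show ?thesis .
qed

text \<open>\<open>c\<close> dominates both the Hardy and the Sobolev constant, so interpolation
  gives P^(q/p) \<le> c E. Together with (q - 1) E \<le> sqrt (A P) this yields the claim after
  squaring and cancelling P.\<close>

proposition weighted_rellich_sobolev:
  assumes n4: "n > 4" and \<alpha>: "- n < \<alpha> - 2" and lower: "\<alpha> - 2 \<le> \<beta>" and upper: "\<beta> \<le> n * \<alpha> / (n - 2)"
  defines "p \<equiv> 2 * (n + \<beta>) / (n - 4 + 2 * \<alpha> - \<beta>)"
  defines "q \<equiv> (p + 2) / 2"
  defines "c \<equiv> max ((q / (n - 2 + \<alpha>))\<^sup>2)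
      ((\<bar>\<alpha> * (n - 1) / (n - 2)\<bar> * (q / (n - 2 + \<alpha>)) + q * (n - 1) / (n - 2))\<^sup>2)"
  shows "((q - 1) / c)\<^sup>2 * moment \<beta> p powr (2 / p)
    \<le> (\<integral>x. norm x powr (- \<beta>) * (weighted_laplacian \<alpha> x)\<^sup>2 \<partial>lborel)"
proof -
  define A where "A = (\<integral>x. norm x powr (- \<beta>) * (weighted_laplacian \<alpha> x)\<^sup>2 \<partial>lborel)"
  define E where "E = energy \<alpha> q"
  define P where "P = moment \<beta> p"
  have s: "n - 2 + \<alpha> > 0" using \<alpha> by simp
  have up: "\<beta> * (n - 2) \<le> n * \<alpha>" using upper n4 by (simp add: field_simps)
  \<comment> \<open>The difference (n-2)(n-4+2\<alpha>-\<beta>) - (n-4)(n-2+\<alpha>) equals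
    n\<alpha> - \<beta>(n-2), which the upper bound on \<beta> makes nonnegative.\<close>
  have d: "n - 4 + 2 * \<alpha> - \<beta> > 0"
  proof -
    have "0 < (n - 4) * (n - 2 + \<alpha>)" using n4 s by simp
    also have "\<dots> \<le> (n - 2) * (n - 4 + 2 * \<alpha> - \<beta>)" using up by (simp add: algebra_simps)
    finally show ?thesis using n4 by (simp add: zero_less_mult_iff)
  qed
  have n\<beta>: "n + \<beta> > 0" using \<alpha> lower by simp
  \<comment> \<open>As the denominator is positive, this is equivalent to \<alpha> - 2 \<le>
    \<beta>.\<close>
  have p2: "p \<ge> 2" using d lower by (simp add: p_def field_simps)
  have q2: "q \<ge> 2" using p2 by (simp add: q_def)
  have p_q: "p = 2 * q - 2" by (simp add: q_def add_divide_distrib)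
  have ratio: "p / q = (n + \<beta>) / (n - 2 + \<alpha>)"
  proof -
    define t where "t = n - 2 + \<alpha>"
    define D where "D = n - 4 + 2 * \<alpha> - \<beta>"
    define M where "M = n + \<beta>"
    have q_eq: "q = 2 * t / D"
      using d by (simp add: q_def p_def t_def D_def field_simps)
    have p_eq: "p = 2 * M / D" by (simp add: p_def D_def M_def)
    have "D > 0" using d by (simp add: D_def)
    then have "p / q = M / t" unfolding q_eq p_eq by simp
    then show ?thesis by (simp add: t_def M_def)
  qed
  \<comment> \<open>The endpoint \<open>l = 1\<close> is Hardy's inequality (\<open>\<beta> = \<alpha> - 2\<close>), and \<open>l = 0\<close> is Sobolev's
    (\<open>\<beta> = n * \<alpha> / (n - 2)\<close>).\<close>
  define l where "l = 1 - (\<beta> + 2 - \<alpha>) * (n - 2) / (2 * (n - 2 + \<alpha>))"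
  have l: "0 \<le> l" "l \<le> 1"
  proof -
    have "(\<beta> + 2 - \<alpha>) * (n - 2) \<ge> 0" using lower n4 by simp
    moreover have "(\<beta> + 2 - \<alpha>) * (n - 2) \<le> 2 * (n - 2 + \<alpha>)" using up by (simp add: algebra_simps)
    ultimately show "0 \<le> l" "l \<le> 1" using s by (simp_all add: l_def)
  qed
  define \<gamma> where "\<gamma> = \<alpha> * n / (n - 2)"
  define m where "m = q * n / (n - 2)"
  have \<gamma>: "\<gamma> > - n"
  proof -
    have "(2 - n) * n < \<alpha> * n" using \<alpha> n4 by (intro mult_strict_right_mono) auto
    then show ?thesis using n4 by (simp add: \<gamma>_def field_simps)
  qed
  have m0: "m \<ge> 0" using q2 n4 by (simp add: m_def)
  have l1: "1 - l = (\<beta> + 2 - \<alpha>) * (n - 2) / (2 * (n - 2 + \<alpha>))" by (simp add: l_def)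
  \<comment> \<open>The Hardy moment contributes \<open>c * E\<close> to the power 1 and the Sobolev
    moment to the power n/(n-2); interpolated with weights l and 1 - l, they give the power
    p/q.\<close>
  have ratio': "l + (1 - l) * (n / (n - 2)) = p / q"
  proof -
    have "l + (1 - l) * (n / (n - 2)) = 1 + (1 - l) * (2 / (n - 2))"
      using n4 by (simp add: field_simps)
    also have "\<dots> = 1 + (\<beta> + 2 - \<alpha>) / (n - 2 + \<alpha>)"
    proof -
      have "d * k / (2 * t) * (2 / k) = d / t" if "k \<noteq> 0" for d k t :: real
        using that by simp
      from this[of "n - 2" "\<beta> + 2 - \<alpha>" "n - 2 + \<alpha>"] show ?thesis unfolding l1 using n4 by linarith
    qed
    also have "\<dots> = p / q" unfolding ratio using s by (simp add: field_simps)
    finally show ?thesis .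
  qed
  have exp_u: "q * l + m * (1 - l) = p"
  proof -
    have "q * l + m * (1 - l) = q * (l + (1 - l) * (n / (n - 2)))"
      by (simp add: m_def algebra_simps)
    also have "\<dots> = p" unfolding ratio' using q2 by simp
    finally show ?thesis .
  qed
  have exp_x: "(\<alpha> - 2) * l + \<gamma> * (1 - l) = \<beta>"
  proof -
    have "(\<alpha> - 2) * l + \<gamma> * (1 - l) = \<alpha> - 2 + (1 - l) * (\<gamma> - \<alpha> + 2)"
      by (simp add: algebra_simps)
    also have "\<gamma> - \<alpha> + 2 = 2 * (n - 2 + \<alpha>) / (n - 2)"
      using n4 by (simp add: \<gamma>_def field_simps)
    also have "(1 - l) * (2 * (n - 2 + \<alpha>) / (n - 2)) = \<beta> + 2 - \<alpha>"
    proof -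
      have "d * k / (2 * t) * (2 * t / k) = d" if "k \<noteq> 0" "t \<noteq> 0" for d k t :: real
        using that by simp
      from this[of "n - 2" "n - 2 + \<alpha>" "\<beta> + 2 - \<alpha>"] show ?thesis unfolding l1 using n4 s by linarith
    qed
    finally show ?thesis by simp
  qed
  have c: "c > 0"
  proof -
    have "(q / (n - 2 + \<alpha>))\<^sup>2 > 0" using q2 s by simp
    then show ?thesis unfolding c_def by (simp add: less_max_iff_disj)
  qed
  have E0: "E \<ge> 0" and P0: "P \<ge> 0" by (simp_all add: E_def P_def energy_nonneg moment_nonneg)
  have "P \<le> moment (\<alpha> - 2) q powr l * moment \<gamma> m powr (1 - l)"
    unfolding P_def moment_def
  proof (rule integral_powr_interpolation)
    show "norm x powr \<beta> * \<bar>u x\<bar> powr p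
        \<le> (norm x powr (\<alpha> - 2) * \<bar>u x\<bar> powr q) powr l * (norm x powr \<gamma> * \<bar>u x\<bar> powr m) powr (1 - l)" for x
    proof -
      have "(norm x powr (\<alpha> - 2) * \<bar>u x\<bar> powr q) powr l * (norm x powr \<gamma> * \<bar>u x\<bar> powr m) powr (1 - l)
        = (norm x powr ((\<alpha> - 2) * l) * norm x powr (\<gamma> * (1 - l)))
          * (\<bar>u x\<bar> powr (q * l) * \<bar>u x\<bar> powr (m * (1 - l)))"
        by (simp add: powr_mult powr_powr mult_ac)
      also have "\<dots> = norm x powr \<beta> * \<bar>u x\<bar> powr p"
        by (simp only: powr_add[symmetric] exp_u exp_x)
      finally show ?thesis by simp
    qed
  qed (use \<alpha> lower l n4 q2 p2 \<gamma> m0 in \<open>auto intro!: integrable_weighted_powr\<close>)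
  also have "\<dots> \<le> (c * E) powr l * ((c * E) powr (n / (n - 2))) powr (1 - l)"
  proof (intro mult_mono powr_mono2)
    have "moment (\<alpha> - 2) q \<le> (q / (n - 2 + \<alpha>))\<^sup>2 * E"
      unfolding E_def using \<alpha> q2 by (intro hardy) auto
    also have "\<dots> \<le> c * E" using E0 by (intro mult_right_mono) (auto simp: c_def)
    finally show "moment (\<alpha> - 2) q \<le> c * E" .
    have "moment \<gamma> m \<le> ((\<bar>\<alpha> * (n - 1) / (n - 2)\<bar> * (q / (n - 2 + \<alpha>)) + q * (n - 1) / (n - 2))\<^sup>2 * E) powr (n / (n - 2))"
      unfolding E_def \<gamma>_def m_def using \<alpha> q2 by (intro sobolev) auto
    also have "\<dots> \<le> (c * E) powr (n / (n - 2))"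
      using E0 n4 by (intro powr_mono2 mult_right_mono) (auto simp: c_def)
    finally show "moment \<gamma> m \<le> (c * E) powr (n / (n - 2))" .
  qed (use l moment_nonneg in auto)
  also have "\<dots> = (c * E) powr (l + (n / (n - 2)) * (1 - l))"
    by (simp only: powr_powr powr_add)
  also have "l + (n / (n - 2)) * (1 - l) = p / q" using ratio' by (simp add: mult.commute)
  finally have P_le: "P \<le> (c * E) powr (p / q)" .
  \<comment> \<open>The moment in \<open>energy_le\<close> is P because p = 2q - 2, and its
    condition on 2\<alpha> - 2 - \<beta> follows from \<open>d\<close>.\<close>
  have E_le: "(q - 1) * E \<le> sqrt (A * P)"
    unfolding E_def A_def P_def p_q using \<alpha> q2 n\<beta> d by (intro energy_le) auto
  have A0: "A \<ge> 0" by (simp add: A_def)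
  show ?thesis
  proof (cases "P = 0")
    case False
    then have P: "P > 0" using P0 by simp
    have "P powr (q / p) \<le> ((c * E) powr (p / q)) powr (q / p)"
      using P_le P q2 p2 by (intro powr_mono2) auto
    also have "\<dots> = c * E" using q2 p2 c E0 by (simp add: powr_powr)
    finally have "(q - 1) / c * P powr (q / p) \<le> (q - 1) / c * (c * E)"
      using q2 c by (intro mult_left_mono) auto
    also have "\<dots> \<le> sqrt (A * P)" using E_le c by simp
    finally have "((q - 1) / c * P powr (q / p))\<^sup>2 \<le> (sqrt (A * P))\<^sup>2"
      using q2 c by (intro power_mono) auto
    then have "((q - 1) / c)\<^sup>2 * (P powr (q / p))\<^sup>2 \<le> A * P"
      using A0 P0 by (simp only: power_mult_distrib) simp
    \<comment> \<open>Since 2q = p + 2, the square contains exactly one full factor P beyond the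
      power 2/p.\<close>
    also have "(P powr (q / p))\<^sup>2 = P powr (2 / p + 1)"
    proof -
      have "q / p + q / p = 2 / p + 1" using p2 by (simp add: q_def field_simps)
      then show ?thesis by (metis power2_eq_square powr_add)
    qed
    also have "\<dots> = P powr (2 / p) * P" using P by (simp add: powr_add)
    finally have "((q - 1) / c)\<^sup>2 * P powr (2 / p) \<le> A" using P by simp
    then show ?thesis by (simp add: P_def A_def)
  qed (use A0 in \<open>simp add: P_def A_def\<close>)
qed

end

section \<open>Test functions\<close>

lemma smooth_fun_derivative:
  assumes "smooth_fun f"
  shows "smooth_fun (\<lambda>x. frechet_derivative f (at x) v)"
  unfolding smooth_fun_def
proof
  fix k
  have "Ck_fun (Suc k) f" using assms unfolding smooth_fun_def by blast
  then show "Ck_fun k (\<lambda>x. frechet_derivative f (at x) v)" by simp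
qed

lemma smooth_fun_has_derivative:
  assumes "smooth_fun f"
  shows "(f has_derivative frechet_derivative f (at x)) (at x)"
proof -
  have "Ck_fun (Suc 0) f" using assms unfolding smooth_fun_def by blast
  then have "f differentiable (at x)" by (simp add: differentiable_on_def)
  then show ?thesis by (simp only: frechet_derivative_works)
qed

lemma smooth_fun_continuous:
  assumes "smooth_fun f"
  shows "continuous_on UNIV f"
proof -
  have "Ck_fun 0 f" using assms unfolding smooth_fun_def by blast
  then show ?thesis by simp
qed

lemma smooth_fun_line_derivative:
  assumes "smooth_fun f"
  shows "((\<lambda>t. f (x + t *\<^sub>R b)) has_real_derivative frechet_derivative f (at x) b) (at 0)"
proof -
  have f: "(f has_derivative frechet_derivative f (at x)) (at (x + 0 *\<^sub>R b))"
    using smooth_fun_has_derivative[OF assms, of x] by simp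
  have l: "((\<lambda>t. x + t *\<^sub>R b) has_derivative (\<lambda>t. t *\<^sub>R b)) (at 0)"
    by (auto intro!: derivative_eq_intros)
  have "((\<lambda>t. f (x + t *\<^sub>R b)) has_derivative (\<lambda>t. frechet_derivative f (at x) (t *\<^sub>R b))) (at 0)"
    by (rule has_derivative_compose[OF l f])
  moreover have "frechet_derivative f (at x) (t *\<^sub>R b) = frechet_derivative f (at x) b * t" for t
    using has_derivative_linear[OF smooth_fun_has_derivative[OF assms, of x]]
    by (simp add: linear_cmul)
  ultimately show ?thesis by (simp add: has_field_derivative_def)
qed

lemma frechet_derivative_eq_0:
  fixes f :: "'a::euclidean_space \<Rightarrow> real"
  assumes zero: "\<And>x. norm x > R \<Longrightarrow> f x = 0" and x: "norm x > R"
  shows "frechet_derivative f (at x) v = 0"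
proof -
  have "open {x::'a. R < norm x}" by (intro open_Collect_less continuous_intros)
  then have "(f has_derivative (\<lambda>_. 0)) (at x)"
    by (rule has_derivative_transform_within_open[OF has_derivative_const]) (use zero x in auto)
  from frechet_derivative_at[OF this] show ?thesis by metis
qed

lemma continuous_bounded_support_bounded:
  fixes f :: "'a::euclidean_space \<Rightarrow> real"
  assumes "continuous_on UNIV f" "\<And>x. norm x > R \<Longrightarrow> f x = 0"
  shows "\<exists>B. \<forall>x. \<bar>f x\<bar> \<le> B"
proof -
  have "compact (f ` cball 0 R)"
    using assms(1) by (intro compact_continuous_image) (auto intro: continuous_on_subset)
  then obtain B where "\<forall>y \<in> f ` cball 0 R. norm y \<le> B"
    using compact_imp_bounded bounded_iff by blast
  then have B: "\<bar>f x\<bar> \<le> B" if "norm x \<le> R" for x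
    using that by simp
  have "\<bar>f x\<bar> \<le> max B 0" for x
    using B[of x] assms(2)[of x] by (cases "norm x \<le> R") auto
  then show ?thesis by blast
qed

section \<open>Gradient and divergence in coordinates\<close>

lemma sum_Basis_axis: "(\<Sum>b\<in>(Basis::(real ^ 'n) set). f b) = (\<Sum>i\<in>UNIV. f (axis i 1))"
proof -
  have B: "(Basis::(real ^ 'n) set) = range (\<lambda>i. axis i 1)"
    by (auto simp: Basis_vec_def)
  have "inj (\<lambda>i::'n. axis i (1::real))"
    by (auto simp: inj_on_def axis_eq_axis)
  then show ?thesis unfolding B by (simp add: sum.reindex)
qed

lemma gradient_inner:
  "b \<in> Basis \<Longrightarrow> gradient f x \<bullet> b = frechet_derivative f (at x) b"
  by (auto simp: Basis_vec_def gradient_def inner_axis)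

lemma has_derivative_norm_powr:
  fixes x :: "'a::euclidean_space"
  assumes "x \<noteq> 0"
  shows "((\<lambda>y. norm y powr a) has_derivative (\<lambda>h. a * norm x powr (a - 2) * (x \<bullet> h))) (at x)"
proof -
  have "((\<lambda>y. norm y) has_derivative (\<lambda>h. inner (sgn x) h)) (at x)"
    using has_derivative_norm[OF assms] by (simp add: inner_commute)
  from has_derivative_powr[OF this has_derivative_const[of a], of ] assms
  have "((\<lambda>y. norm y powr a) has_derivative (\<lambda>h. norm x powr a * (sgn x \<bullet> h * a / norm x))) (at x)"
    by simp
  moreover have "norm x powr a * (sgn x \<bullet> h * a / norm x) = a * norm x powr (a - 2) * (x \<bullet> h)" for h
    using assms by (simp add: sgn_div_norm powr_diff power2_eq_square field_simps)
  ultimately show ?thesis by simp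
qed

lemma has_derivative_gradient:
  fixes u :: "real ^ 'n \<Rightarrow> real"
  assumes "smooth_fun u"
  shows "(gradient u has_derivative
    (\<lambda>h. \<chi> i. frechet_derivative (\<lambda>y. frechet_derivative u (at y) (axis i 1)) (at x) h)) (at x)"
proof (subst has_derivative_componentwise_within, intro ballI)
  fix b :: "real ^ 'n" assume "b \<in> Basis"
  then obtain i where i: "b = axis i 1" by (auto simp: Basis_vec_def)
  show "((\<lambda>y. gradient u y \<bullet> b) has_derivative
    (\<lambda>h. (\<chi> i. frechet_derivative (\<lambda>y. frechet_derivative u (at y) (axis i 1)) (at x) h) \<bullet> b)) (at x)"
    using smooth_fun_has_derivative[OF smooth_fun_derivative[OF assms, of "axis i 1"], of x]
    by (simp add: i inner_axis gradient_def)
qed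

text \<open>The product rule, which applies because the norm is differentiable away from the origin;
  the result has the shape of \<open>weighted_laplacian\<close>.\<close>

lemma divergence_norm_powr_gradient:
  fixes u :: "real ^ 'n \<Rightarrow> real"
  assumes "smooth_fun u" "x \<noteq> 0"
  shows "divergence (\<lambda>y. norm y powr \<alpha> *\<^sub>R gradient u y) x =
    norm x powr \<alpha> * (\<Sum>b\<in>Basis. frechet_derivative (\<lambda>y. frechet_derivative u (at y) b) (at x) b)
      + \<alpha> * norm x powr (\<alpha> - 2) * (x \<bullet> gradient u x)"
proof -
  have "((\<lambda>y. norm y powr \<alpha> *\<^sub>R gradient u y) has_derivative
    (\<lambda>h. norm x powr \<alpha> *\<^sub>R (\<chi> i. frechet_derivative (\<lambda>y. frechet_derivative u (at y) (axis i 1)) (at x) h)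
      + (\<alpha> * norm x powr (\<alpha> - 2) * (x \<bullet> h)) *\<^sub>R gradient u x)) (at x)"
    by (rule has_derivative_scaleR[OF has_derivative_norm_powr[OF assms(2)] has_derivative_gradient[OF assms(1)]])
  note fd = frechet_derivative_at[OF this, symmetric]
  have "x \<bullet> axis i 1 = x $ i" for i
    by (simp add: inner_axis)
  then have inner: "(\<Sum>i\<in>UNIV. (x \<bullet> axis i 1) * gradient u x $ i) = x \<bullet> gradient u x"
    by (simp only: inner_vec_def[of x "gradient u x"] inner_real_def)
  have "divergence (\<lambda>y. norm y powr \<alpha> *\<^sub>R gradient u y) x =
    (\<Sum>i\<in>UNIV. norm x powr \<alpha> * frechet_derivative (\<lambda>y. frechet_derivative u (at y) (axis i 1)) (at x) (axis i 1)
      + \<alpha> * norm x powr (\<alpha> - 2) * ((x \<bullet> axis i 1) * gradient u x $ i))"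
    unfolding divergence_def fd by (intro sum.cong refl) simp
  also have "\<dots> = norm x powr \<alpha> * (\<Sum>b\<in>Basis. frechet_derivative (\<lambda>y. frechet_derivative u (at y) b) (at x) b)
      + \<alpha> * norm x powr (\<alpha> - 2) * (x \<bullet> gradient u x)"
    unfolding sum.distrib sum_Basis_axis sum_distrib_left[symmetric] inner ..
  finally show ?thesis .
qed

lemma test_fun_bounded_support_hessian:
  fixes u :: "real ^ 'n \<Rightarrow> real"
  assumes u: "test_fun u" and dim: "CARD('n) > 2"
  obtains R C where "bounded_support_hessian u (gradient u) R C
    (\<lambda>b x. frechet_derivative (\<lambda>y. frechet_derivative u (at y) b) (at x) b)"
proof -
  have smooth: "smooth_fun u" and "compact (closure {x. u x \<noteq> 0})"
    using u by (auto simp: test_fun_def)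
  then obtain R where "\<forall>x\<in>closure {x. u x \<noteq> 0}. norm x \<le> R"
    using compact_imp_bounded bounded_iff by blast
  \<comment> \<open>The absolute value provides the nonnegative radius that the locale
    requires.\<close>
  then have R: "u x = 0" if "norm x > \<bar>R\<bar>" for x
    using that closure_subset[of "{x. u x \<noteq> 0}"] by fastforce
  define D where "D b x = frechet_derivative u (at x) b" for b x
  define H where "H b x = frechet_derivative (D b) (at x) b" for b x
  have D_smooth: "smooth_fun (D b)" for b
    unfolding D_def[abs_def] by (rule smooth_fun_derivative[OF smooth])
  have H_smooth: "smooth_fun (H b)" for b
    unfolding H_def[abs_def] by (rule smooth_fun_derivative[OF D_smooth])
  have D0: "D b x = 0" if "norm x > \<bar>R\<bar>" for b x
    unfolding D_def using R that by (rule frechet_derivative_eq_0)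
  have H0: "H b x = 0" if "norm x > \<bar>R\<bar>" for b x
    unfolding H_def using D0 that by (rule frechet_derivative_eq_0)
  have grad: "gradient u x = (\<Sum>b\<in>Basis. D b x *\<^sub>R b)" for x
    by (rule euclidean_eqI) (simp add: gradient_inner D_def inner_sum_left inner_Basis if_distrib cong: if_cong)
  have cont: "continuous_on UNIV u" "continuous_on UNIV (D b)" "continuous_on UNIV (H b)" for b
    using smooth D_smooth H_smooth by (auto intro: smooth_fun_continuous)
  have grad_cont: "continuous_on UNIV (gradient u)"
    unfolding grad[abs_def] by (intro continuous_intros cont)
  \<comment> \<open>A single continuous function of bounded support dominates u, its gradient and
    all \<open>H b\<close>, so its bound is a common constant \<open>C\<close>.\<close>
  define F where "F x = \<bar>u x\<bar> + norm (gradient u x) + (\<Sum>b\<in>(Basis :: (real ^ 'n) set). \<bar>H b x\<bar>)" for x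
  have "continuous_on UNIV F"
    unfolding F_def by (intro continuous_intros cont grad_cont)
  moreover have "F x = 0" if "norm x > \<bar>R\<bar>" for x
    using that by (simp add: F_def R D0 H0 grad)
  ultimately obtain C where C: "\<And>x. \<bar>F x\<bar> \<le> C"
    using continuous_bounded_support_bounded by metis
  have F_ge: "\<bar>u x\<bar> \<le> F x" "norm (gradient u x) \<le> F x" for x
    by (auto simp: F_def sum_nonneg)
  have F_ge': "\<bar>H b x\<bar> \<le> F x" if "b \<in> Basis" for b x
  proof -
    have "\<bar>H b x\<bar> \<le> (\<Sum>b\<in>(Basis :: (real ^ 'n) set). \<bar>H b x\<bar>)"
      by (rule member_le_sum) (use that in auto)
    then show ?thesis unfolding F_def by (smt (verit) norm_ge_zero)
  qed
  have F_le: "F x \<le> C" for x using C[of x] by linarith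
  have "bounded_support_hessian u (gradient u) \<bar>R\<bar> C H"
  proof
    show "DIM(real ^ 'n) > 2" using dim by simp
    show "u \<in> borel_measurable borel" "gradient u \<in> borel_measurable borel"
      "\<And>b. H b \<in> borel_measurable borel"
      by (intro borel_measurable_continuous_onI cont grad_cont)+
    show "((\<lambda>t. u (x + t *\<^sub>R b)) has_real_derivative gradient u x \<bullet> b) (at 0)" if "b \<in> Basis" for b x
      using smooth_fun_line_derivative[OF smooth, of x b] that by (simp add: gradient_inner)
    show "((\<lambda>t. gradient u (x + t *\<^sub>R b) \<bullet> b) has_real_derivative H b x) (at 0)" if "b \<in> Basis" for b x
      using smooth_fun_line_derivative[OF D_smooth[of b], of x b] that by (simp add: gradient_inner D_def H_def)
    show "gradient u x = 0" if "norm x > \<bar>R\<bar>" for x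
      using that by (simp add: grad D0)
    show "\<bar>u x\<bar> \<le> C" "norm (gradient u x) \<le> C" for x
      using F_ge[of x] F_le[of x] by linarith+
    show "\<bar>H b x\<bar> \<le> C" if "b \<in> Basis" for b x
      using F_ge'[OF that, of x] F_le[of x] by linarith
  qed (use R H0 in auto)
  then show ?thesis using that[of "\<bar>R\<bar>" C] by (simp add: H_def[abs_def] D_def[abs_def])
qed

section \<open>The constant and the passage to test functions\<close>

theorem proposition4p1:
  fixes \<alpha> \<beta> N :: real
  assumes N_def: "N = real CARD('n::finite)"
    and N_ge: "CARD('n) \<ge> 5"
    and lower: "- N < \<alpha> - 2"
    and middle: "\<alpha> - 2 \<le> \<beta>"
    and upper: "\<beta> \<le> N * \<alpha> / (N - 2)"
  shows "\<exists>S>0. \<forall>u :: real ^ 'n \<Rightarrow> real. test_fun u \<longrightarrow>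
    (LINT x|lborel. norm x powr (- \<beta>) *
        \<bar>divergence (\<lambda>y. norm y powr \<alpha> *\<^sub>R gradient u y) x\<bar>\<^sup>2)
    \<ge> S * (LINT x|lborel. norm x powr \<beta> * \<bar>u x\<bar> powr crit_exp N \<alpha> \<beta>)
            powr (2 / crit_exp N \<alpha> \<beta>)"
proof -
  define p where "p = crit_exp N \<alpha> \<beta>"
  define q where "q = (p + 2) / 2"
  define c where "c = max ((q / (N - 2 + \<alpha>))\<^sup>2)
      ((\<bar>\<alpha> * (N - 1) / (N - 2)\<bar> * (q / (N - 2 + \<alpha>)) + q * (N - 1) / (N - 2))\<^sup>2)"
  have N: "N > 4" using N_def N_ge by simp
  have "p > 0"
  \<comment> \<open>The positivity of the denominator is derived here from the parameters alone,
    since the constant must be fixed before u.\<close>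
  proof -
    have "\<beta> * (N - 2) \<le> N * \<alpha>" using upper N by (simp add: field_simps)
    moreover have "0 < (N - 4) * (N - 2 + \<alpha>)" using N lower by simp
    ultimately have "0 < (N - 2) * (N - 4 + 2 * \<alpha> - \<beta>)" by (simp add: algebra_simps)
    then have "N - 4 + 2 * \<alpha> - \<beta> > 0" using N by (simp add: zero_less_mult_iff)
    then show ?thesis using lower middle by (simp add: p_def crit_exp_def)
  qed
  then have q: "q > 1" by (simp add: q_def)
  then have "(q / (N - 2 + \<alpha>))\<^sup>2 > 0" using lower by simp
  then have c: "c > 0" by (simp add: c_def less_max_iff_disj)
  show ?thesis
  \<comment> \<open>The witness is the constant of \<open>weighted_rellich_sobolev\<close>; it
    depends only on N, \<alpha> and \<beta>.\<close>
  proof (intro exI[of _ "((q - 1) / c)\<^sup>2"] conjI allI impI)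
    show "((q - 1) / c)\<^sup>2 > 0" using q c by simp
    fix u :: "real ^ 'n \<Rightarrow> real" assume u: "test_fun u"
    define H where "H b x = frechet_derivative (\<lambda>y. frechet_derivative u (at y) b) (at x) b" for b x
    obtain R C where "bounded_support_hessian u (gradient u) R C H"
      using test_fun_bounded_support_hessian[OF u] N_ge unfolding H_def[abs_def] by auto
    then interpret bounded_support_hessian u "gradient u" R C H .
    have n_eq: "n = N" by (simp add: n_def N_def)
    have eq: "norm x powr (- \<beta>) * \<bar>divergence (\<lambda>y. norm y powr \<alpha> *\<^sub>R gradient u y) x\<bar>\<^sup>2
        = norm x powr (- \<beta>) * (weighted_laplacian \<alpha> x)\<^sup>2" for x
    \<comment> \<open>At the origin \<open>divergence\<close> is unspecified, but
      \<open>0 powr (- \<beta>) = 0\<close>, so the integrands agree everywhere.\<close>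
    proof (cases "x = 0")
      case False
      then show ?thesis
        using divergence_norm_powr_gradient[of u x \<alpha>] u
        by (simp add: test_fun_def weighted_laplacian_def H_def)
    qed simp
    show "((q - 1) / c)\<^sup>2 * (LINT x|lborel. norm x powr \<beta> * \<bar>u x\<bar> powr crit_exp N \<alpha> \<beta>)
            powr (2 / crit_exp N \<alpha> \<beta>)
      \<le> (LINT x|lborel. norm x powr (- \<beta>) *
        \<bar>divergence (\<lambda>y. norm y powr \<alpha> *\<^sub>R gradient u y) x\<bar>\<^sup>2)"
      using weighted_rellich_sobolev[of \<alpha> \<beta>] N lower middle upper
      unfolding eq n_eq moment_def c_def q_def p_def crit_exp_def by blast
  qed
qed

end
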